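(* Let $a$, $b$ and $n$ be positive integers such that $2\leq a<b$, $a\equiv b \pmod 2$, and $na$ is even. Let $G$ be a connected graph on $n$ vertices with $$n\geq \max\{2a^2+136a+264,\ 2b^2+5ab+7b+34\}$$ and minimum degree $\delta(G)\geq a$. If $\rho(G)\geq \rho(G_n^a)$, then $G$ contains a parity $[a,b]$-factor unless $G\cong G_n^a$.
   Context: All graphs are finite, simple and undirected. $\rho(G)$ denotes the spectral radius (largest eigenvalue) of the adjacency matrix of $G$. For positive integers $a\le b$ with $a\equiv b \pmod 2$, a parity $[a,b]$-factor of $G$ is a spanning subgraph $H$ of $G$ such that for every vertex $v$, $a\leq d_H(v)\leq b$ and $d_H(v)\equiv a\equiv b \pmod 2$. $K_m$ denotes the complete graph on $m$ vertices, $mK_1$ the edgeless graph on $m$ vertices, $G_1\cup G_2$ the disjoint union, and $G_1\vee G_2$ the join (disjoint union plus all edges between $V(G_1)$ and $V(G_2)$). The graph $G_n^a$ is obtained from $K_{a-1}\vee(K_{n-2a-1}\cup (a+1)K_1)$ by adding one new vertex and joining it to each of the $a+1$ vertices of $(a+1)K_1$; it has $n$ vertices. *)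

theory Defs
  imports
    "Graph_Theory.Graph_Theory"
    "Jordan_Normal_Form.Spectral_Radius"
begin

text \<open>
  A finite simple undirected graph is a \<^locale>\<open>pair_graph\<close>: each edge is represented by its
  two opposite arcs, so the degree of a vertex is its \<^const>\<open>out_degree\<close>.
\<close>

definition min_degree :: "'a pair_pre_digraph \<Rightarrow> nat" where
  "min_degree G = Min (out_degree G ` pverts G)"


section \<open>Spectral radius\<close>

text \<open>
  Matrices are indexed by natural numbers, so the vertices have to be enumerated.
  Lemma \<open>eigenvalue_adj_matrix_iff\<close> below shows that the choice of the
  enumeration does not affect the spectrum.
\<close>

definition vertex_list :: "'a pair_pre_digraph \<Rightarrow> 'a list" where
  "vertex_list G = (SOME vs. set vs = pverts G \<and> distinct vs)"

definition adj_matrix :: "'a pair_pre_digraph \<Rightarrow> complex mat" where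
  "adj_matrix G = (let vs = vertex_list G in
     mat (length vs) (length vs) (\<lambda>(i, j). if (vs ! i, vs ! j) \<in> parcs G then 1 else 0))"

text \<open>
  \<^const>\<open>spectral_radius\<close> is the largest modulus of a complex eigenvalue. As the
  adjacency matrix is symmetric and nonnegative, this is its largest eigenvalue.
\<close>

definition graph_spectral_radius :: "'a pair_pre_digraph \<Rightarrow> real" where
  "graph_spectral_radius G = spectral_radius (adj_matrix G)"


section \<open>Parity factors\<close>

definition parity_factor ::
  "nat \<Rightarrow> nat \<Rightarrow> 'a pair_pre_digraph \<Rightarrow> 'a pair_pre_digraph \<Rightarrow> bool" where
  "parity_factor a b H G \<longleftrightarrow>
     pair_graph H \<and> spanning H G \<and>
     (\<forall>v\<in>pverts H. a \<le> out_degree H v \<and> out_degree H v \<le> b \<and>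
        out_degree H v mod 2 = a mod 2 \<and> out_degree H v mod 2 = b mod 2)"


section \<open>Graph constructions\<close>

definition complete_graph :: "nat \<Rightarrow> nat pair_pre_digraph" where
  "complete_graph m = \<lparr>pverts = {..<m}, parcs = {(i, j). i < m \<and> j < m \<and> i \<noteq> j}\<rparr>"

definition edgeless_graph :: "nat \<Rightarrow> nat pair_pre_digraph" where
  "edgeless_graph m = \<lparr>pverts = {..<m}, parcs = {}\<rparr>"

definition disjoint_union ::
  "'a pair_pre_digraph \<Rightarrow> 'b pair_pre_digraph \<Rightarrow> ('a + 'b) pair_pre_digraph" where
  "disjoint_union G H = \<lparr>pverts = pverts G <+> pverts H,
     parcs = map_prod Inl Inl ` parcs G \<union> map_prod Inr Inr ` parcs H\<rparr>"

definition graph_join ::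
  "'a pair_pre_digraph \<Rightarrow> 'b pair_pre_digraph \<Rightarrow> ('a + 'b) pair_pre_digraph" where
  "graph_join G H = \<lparr>pverts = pverts G <+> pverts H,
     parcs = parcs (disjoint_union G H)
       \<union> (Inl ` pverts G \<times> Inr ` pverts H) \<union> (Inr ` pverts H \<times> Inl ` pverts G)\<rparr>"

text \<open>The new vertex is \<^const>\<open>None\<close>; it is joined to the vertices in \<open>S\<close>.\<close>

definition add_vertex ::
  "'a set \<Rightarrow> 'a pair_pre_digraph \<Rightarrow> 'a option pair_pre_digraph" where
  "add_vertex S G = \<lparr>pverts = insert None (Some ` pverts G),
     parcs = map_prod Some Some ` parcs G \<union> ({None} \<times> Some ` S) \<union> (Some ` S \<times> {None})\<rparr>"

text \<open>
  The subtractions are only meaningful for \<open>a \<ge> 1\<close> and \<open>n \<ge> 2 * a + 1\<close>.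
\<close>

definition extremal_graph :: "nat \<Rightarrow> nat \<Rightarrow> (nat + nat + nat) option pair_pre_digraph" where
  "extremal_graph n a =
     add_vertex (Inr ` Inr ` pverts (edgeless_graph (a + 1)))
       (graph_join (complete_graph (a - 1))
         (disjoint_union (complete_graph (n - 2 * a - 1)) (edgeless_graph (a + 1))))"


section \<open>Sanity checks\<close>

lemma finite_vertex_list:
  assumes "finite (pverts G)"
  shows "set (vertex_list G) = pverts G" "distinct (vertex_list G)"
  using someI_ex[OF finite_distinct_list[OF assms]] unfolding vertex_list_def by auto

lemma eigenvalue_adj_matrix_iff:
  assumes "finite (pverts G)"
  shows "eigenvalue (adj_matrix G) k \<longleftrightarrow>
    (\<exists>f. (\<exists>v\<in>pverts G. f v \<noteq> 0) \<and>
         (\<forall>u\<in>pverts G. (\<Sum>v | v \<in> pverts G \<and> (u, v) \<in> parcs G. f v) = k * f u))"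
    (is "_ \<longleftrightarrow> ?R")
proof -
  define vs where "vs = vertex_list G"
  define n where "n = length vs"
  have vs: "set vs = pverts G" "distinct vs"
    using finite_vertex_list[OF assms] by (auto simp: vs_def)
  have A: "adj_matrix G = mat n n (\<lambda>(i, j). if (vs ! i, vs ! j) \<in> parcs G then 1 else 0)"
    by (simp add: adj_matrix_def vs_def n_def Let_def)
  have bij: "bij_betw ((!) vs) {0..<n} (pverts G)"
    by (rule bij_betw_nth) (auto simp: vs n_def)
  have mem: "vs ! i \<in> pverts G" if "i < n" for i
    using nth_mem[of i vs] that unfolding vs(1) n_def .
  have sum_eq: "(\<Sum>v | v \<in> pverts G \<and> (u, v) \<in> parcs G. f v) =
      (\<Sum>j = 0..<n. (if (u, vs ! j) \<in> parcs G then 1 else 0) * f (vs ! j))" for u and f :: "_ \<Rightarrow> complex"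
  proof -
    have "(\<Sum>v | v \<in> pverts G \<and> (u, v) \<in> parcs G. f v)
        = (\<Sum>v\<in>pverts G. (if (u, v) \<in> parcs G then 1 else 0) * f v)"
      using assms by (simp add: sum.inter_filter if_distrib[of "\<lambda>x. x * _"] cong: if_cong)
    also have "\<dots> = (\<Sum>j = 0..<n. (if (u, vs ! j) \<in> parcs G then 1 else 0) * f (vs ! j))"
      using sum.reindex_bij_betw[OF bij, symmetric] by fast
    finally show ?thesis .
  qed
  show ?thesis
  proof
    assume "eigenvalue (adj_matrix G) k"
    then obtain x where x: "x \<in> carrier_vec n" "x \<noteq> 0\<^sub>v n" "adj_matrix G *\<^sub>v x = k \<cdot>\<^sub>v x"
      unfolding eigenvalue_def eigenvector_def A by auto
    define f where "f v = x $ (the_inv_into {0..<n} ((!) vs) v)" for v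
    have f: "f (vs ! i) = x $ i" if "i < n" for i
      using that bij by (simp add: f_def the_inv_into_f_f bij_betw_def)
    have "\<exists>i<n. x $ i \<noteq> 0"
    proof (rule ccontr)
      assume "\<not> ?thesis"
      hence "x = 0\<^sub>v n" using x(1) by (intro eq_vecI) auto
      with x(2) show False by simp
    qed
    then obtain i where "i < n" "x $ i \<noteq> 0" by blast
    hence "f (vs ! i) \<noteq> 0" by (simp only: f not_False_eq_True)
    hence "\<exists>v\<in>pverts G. f v \<noteq> 0" using mem[OF \<open>i < n\<close>] ..
    moreover have "(\<Sum>v | v \<in> pverts G \<and> (u, v) \<in> parcs G. f v) = k * f u" if u: "u \<in> pverts G" for u
    proof -
      obtain i where i: "i < n" "u = vs ! i"
        using u unfolding vs(1)[symmetric] in_set_conv_nth n_def by blast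
      have "(\<Sum>v | v \<in> pverts G \<and> (u, v) \<in> parcs G. f v) = (adj_matrix G *\<^sub>v x) $ i"
        unfolding sum_eq using i x(1) by (auto simp: A scalar_prod_def f intro!: sum.cong)
      also have "\<dots> = k * f u" using x(1,3) i f by simp
      finally show ?thesis .
    qed
    ultimately show ?R by blast
  next
    assume ?R
    then obtain f where f: "\<exists>v\<in>pverts G. f v \<noteq> 0"
      "\<forall>u\<in>pverts G. (\<Sum>v | v \<in> pverts G \<and> (u, v) \<in> parcs G. f v) = k * f u" by blast
    define x where "x = vec n (\<lambda>i. f (vs ! i))"
    obtain i where i: "i < n" "f (vs ! i) \<noteq> 0"
      using f(1) unfolding vs(1)[symmetric] in_set_conv_nth Bex_def n_def by blast
    hence "x $ i \<noteq> 0\<^sub>v n $ i" by (simp add: x_def)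
    hence "x \<noteq> 0\<^sub>v n" by metis
    moreover have "adj_matrix G *\<^sub>v x = k \<cdot>\<^sub>v x"
    proof (rule eq_vecI)
      fix i assume "i < dim_vec (k \<cdot>\<^sub>v x)"
      hence i: "i < n" by (simp add: x_def)
      have "(adj_matrix G *\<^sub>v x) $ i = (\<Sum>v | v \<in> pverts G \<and> (vs ! i, v) \<in> parcs G. f v)"
        unfolding sum_eq using i by (auto simp: A scalar_prod_def x_def intro!: sum.cong)
      also have "\<dots> = (k \<cdot>\<^sub>v x) $ i" using f(2) mem[OF i] i by (simp add: x_def)
      finally show "(adj_matrix G *\<^sub>v x) $ i = (k \<cdot>\<^sub>v x) $ i" .
    qed (simp add: A x_def)
    ultimately show "eigenvalue (adj_matrix G) k"
      unfolding eigenvalue_def eigenvector_def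
      by (intro exI[of _ x]) (auto simp: A x_def)
  qed
qed

lemma pair_graph_iff:
  "pair_graph G \<longleftrightarrow> finite (pverts G) \<and> parcs G \<subseteq> pverts G \<times> pverts G \<and>
     (\<forall>v. (v, v) \<notin> parcs G) \<and> sym (parcs G)"
    (is "_ \<longleftrightarrow> ?R")
proof
  assume "pair_graph G"
  then interpret pair_graph G .
  have "parcs G \<subseteq> pverts G \<times> pverts G"
    using in_arcsD1 in_arcsD2 by (intro subrelI SigmaI)
  moreover have "\<forall>v. (v, v) \<notin> parcs G"
    using no_loops' by blast
  moreover have "sym (parcs G)"
    using arcs_symmetric by (intro symI)
  ultimately show ?R using pair_finite_verts by blast
next
  assume R: ?R
  show "pair_graph G"
  proof unfold_locales
    show "finite (parcs G)"
      using R by (blast intro: finite_subset finite_SigmaI)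
    show "symmetric G"
      using R by (simp add: symmetric_def)
  qed (use R in \<open>auto simp: subset_iff mem_Times_iff\<close>)
qed

lemma pair_graph_complete_graph: "pair_graph (complete_graph m)"
  by (auto simp: pair_graph_iff complete_graph_def intro!: symI)

lemma pair_graph_edgeless_graph: "pair_graph (edgeless_graph m)"
  by (simp add: pair_graph_iff edgeless_graph_def sym_def)

lemma sym_map_prod: "sym E \<Longrightarrow> sym (map_prod f f ` E)"
  by (force intro!: symI dest: symD)

lemma sym_Times_Un: "sym (A \<times> B \<union> B \<times> A)"
  by (rule symI) blast

lemma pair_graph_disjoint_union:
  assumes "pair_graph G" "pair_graph H"
  shows "pair_graph (disjoint_union G H)"
  using assms unfolding pair_graph_iff
  by (intro conjI; (simp add: disjoint_union_def sym_Un sym_map_prod; fail)?)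
    (auto simp: disjoint_union_def)

lemma pair_graph_join:
  assumes "pair_graph G" "pair_graph H"
  shows "pair_graph (graph_join G H)"
proof -
  have D: "parcs (disjoint_union G H) \<subseteq> (pverts G <+> pverts H) \<times> (pverts G <+> pverts H)"
    "\<forall>v. (v, v) \<notin> parcs (disjoint_union G H)" "sym (parcs (disjoint_union G H))"
    "finite (pverts G <+> pverts H)"
    using pair_graph_disjoint_union[OF assms] by (simp_all add: pair_graph_iff disjoint_union_def)
  have "sym (parcs (graph_join G H))"
    using sym_Un[OF D(3) sym_Times_Un[of "Inl ` pverts G" "Inr ` pverts H"]]
    by (simp add: graph_join_def Un_assoc)
  thus ?thesis using D(1,2,4) unfolding pair_graph_iff
    by (auto simp: graph_join_def)
qed

lemma pair_graph_add_vertex: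
  assumes "pair_graph G" "S \<subseteq> pverts G"
  shows "pair_graph (add_vertex S G)"
proof -
  have "sym (parcs (add_vertex S G))"
    using sym_Un[OF sym_map_prod[of "parcs G" Some] sym_Times_Un[of "{None}" "Some ` S"]] assms(1)
    by (simp add: add_vertex_def Un_assoc pair_graph_iff)
  thus ?thesis using assms unfolding pair_graph_iff
    by (auto simp: add_vertex_def)
qed

lemma pair_graph_extremal_graph: "pair_graph (extremal_graph n a)"
  unfolding extremal_graph_def
  by (intro pair_graph_add_vertex pair_graph_join pair_graph_disjoint_union
      pair_graph_complete_graph pair_graph_edgeless_graph)
    (auto simp: graph_join_def disjoint_union_def)

lemma card_extremal_graph:
  assumes "a \<ge> 1" "n \<ge> 2 * a + 1"
  shows "card (pverts (extremal_graph n a)) = n"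
  using assms
  by (simp add: extremal_graph_def add_vertex_def graph_join_def disjoint_union_def
      edgeless_graph_def complete_graph_def card_image card_Plus)

end

theory Submission
  imports Defs "HOL-Analysis.Function_Topology"
begin

text \<open>
  The extremal graph contains a clique on \<open>n - a - 2\<close> vertices, so \<open>\<rho>(G) \<ge> n - a - 3\<close>, and Hong's
  bound \<open>\<rho>\<^sup>2 \<le> 2|E| - n + 1\<close> makes \<open>G\<close> so dense that at most \<open>a + 2\<close> vertices (the set \<open>T\<close>) have
  degree below \<open>5a + 12\<close> and at most \<open>2a + 6\<close> vertices (the set \<open>M\<close>) have degree below about
  \<open>n/2 + 3a\<close>. A factor with all degrees in \<open>{a, a + 2}\<close> is built by first choosing edges at \<open>T\<close>, then
  greedily at \<open>M\<close>, and finally completing by an \<open>f\<close>-factor of the rest, whose minimum degree exceeds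
  half its order. Only the first step can fail, and only if \<open>|T| = a + 2\<close>, the number of vertices \<open>z\<close>
  with neighbourhood \<open>T - {z}\<close> is odd and all other vertices of \<open>T\<close> have degree \<open>a\<close>. In that case,
  moving the edges between \<open>T - {z}\<close> and the rest to the \<open>a - 1\<close> vertices with the largest Perron
  entries, and completing the rest to a clique, gives a copy of \<open>G_n^a\<close> without decreasing the Rayleigh
  quotient; so \<open>\<rho>(G) \<ge> \<rho>(G_n^a)\<close> forces equality throughout, and \<open>G\<close> is that copy.
\<close>

section \<open>Factors with degrees \<open>a\<close> and \<open>a + 2\<close>\<close>

text \<open>The obstacle at \<open>T\<close> is parity. If \<open>card T = a + 2\<close>, a vertex
  whose neighbourhood is the rest of \<open>T\<close> has degree \<open>a + 1\<close> and must drop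
  exactly one edge. If all other vertices of \<open>T\<close> have degree \<open>a\<close>, they can
  drop nothing, so the dropped edges would form a perfect matching on an odd set. Hong's bound
  leaves fewer than \<open>(a + 2) * n\<close> missing edges. A vertex of bounded degree misses
  almost \<open>n\<close> of them and one of degree near \<open>n / 2\<close> about half as many;
  hence the sizes \<open>a + 2\<close> and, with slack, \<open>2 * a + 6\<close>. The degree
  thresholds are then read off backwards from what the later steps consume. The bound on
  \<open>n\<close> in terms of \<open>b\<close> enters through its value at
  \<open>b = a + 2\<close>. In the exceptional case, equality of Rayleigh quotients does not
  identify the graph at once, since Perron entries may tie. The missing information comes from the
  eigenvalue equations of the rearranged graph, for which the same vector is a maximiser.\<close>

abbreviation deg :: "('a \<times> 'a) set \<Rightarrow> 'a \<Rightarrow> nat" where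
  "deg E v \<equiv> card (E `` {v})"

section \<open>Parity and degree sums of symmetric relations\<close>

lemma even_card_sym_irrefl:
  assumes "finite F" "sym F" "irrefl F"
  shows "even (card F)"
  using assms
proof (induction "card F" arbitrary: F rule: less_induct)
  case less
  show ?case
  proof (cases "F = {}")
    case False
    then obtain u v where uv: "(u, v) \<in> F" by auto
    have ne: "u \<noteq> v" and vu: "(v, u) \<in> F"
      using uv less.prems by (auto simp: irrefl_def dest: symD)
    define F' where "F' = F - {(u, v), (v, u)}"
    have c: "card F = card F' + 2"
    proof -
      have "card F' = card F - card {(u, v), (v, u)}"
        unfolding F'_def using uv vu by (intro card_Diff_subset) auto
      moreover have "card {(u, v), (v, u)} = 2" using ne by auto
      moreover have "card {(u, v), (v, u)} \<le> card F"
        using uv vu less.prems by (intro card_mono) auto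
      ultimately show ?thesis by linarith
    qed
    have "sym F'" using less.prems unfolding F'_def sym_def by auto
    moreover have "irrefl F'" using less.prems unfolding F'_def irrefl_def by auto
    ultimately have "even (card F')" using less.hyps[of F'] less.prems c
      by (simp add: F'_def)
    thus ?thesis using c by simp
  qed auto
qed

lemma sum_deg:
  assumes "finite V" "F \<subseteq> V \<times> V"
  shows "(\<Sum>v\<in>V. deg F v) = card F"
proof -
  have f: "finite (F `` {v})" for v using assms by (meson finite_Image finite_SigmaI finite_subset)
  have "F = (SIGMA v:V. F `` {v})" using assms by auto
  hence "card F = card (SIGMA v:V. F `` {v})" by simp
  also have "\<dots> = (\<Sum>v\<in>V. deg F v)" using assms f by (intro card_SigmaI) auto
  finally show ?thesis ..
qed

lemma even_sum_deg:
  assumes "finite V" "F \<subseteq> V \<times> V" "sym F" "irrefl F"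
  shows "even (\<Sum>v\<in>V. deg F v)"
  unfolding sum_deg[OF assms(1,2)]
  using assms by (intro even_card_sym_irrefl) (auto intro: finite_subset)

lemma deg_Un_disjoint:
  assumes "finite (F `` {v})" "finite (H `` {v})" "F `` {v} \<inter> H `` {v} = {}"
  shows "deg (F \<union> H) v = deg F v + deg H v"
  using assms by (simp add: Un_Image card_Un_disjoint)

section \<open>Choosing the edges at \<open>T\<close>\<close>

lemma ex_perfect_matching:
  assumes "finite S" "even (card S)"
  shows "\<exists>D \<subseteq> S \<times> S. sym D \<and> irrefl D \<and> (\<forall>s\<in>S. deg D s = 1)"
  using assms
proof (induction "card S" arbitrary: S rule: less_induct)
  case less
  show ?case
  proof (cases "S = {}")
    case True
    then show ?thesis by (auto simp: irrefl_def sym_def)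
  next
    case False
    then obtain s where s: "s \<in> S" by auto
    have "S \<noteq> {s}" using less.prems by auto
    then obtain t where t: "t \<in> S" "t \<noteq> s" using s by auto
    define S' where "S' = S - {s, t}"
    have "card S' = card S - card {s, t}"
      unfolding S'_def using s t by (intro card_Diff_subset) auto
    moreover have "card {s, t} = 2" using t by auto
    moreover have "card {s, t} \<le> card S" using s t less.prems by (intro card_mono) auto
    ultimately have "card S = card S' + 2" by linarith
    then obtain D where D: "D \<subseteq> S' \<times> S'" "sym D" "irrefl D" "\<forall>s\<in>S'. deg D s = 1"
      using less.hyps[of S'] less.prems by (auto simp: S'_def)
    define D' where "D' = D \<union> {(s, t), (t, s)}"
    have "D' \<subseteq> S \<times> S" "sym D'" "irrefl D'"
      using D s t unfolding D'_def S'_def sym_def irrefl_def by auto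
    moreover have "deg D' x = 1" if "x \<in> S" for x
    proof (cases "x \<in> S'")
      case True
      hence "D' `` {x} = D `` {x}" unfolding D'_def S'_def by auto
      thus ?thesis using D True by simp
    next
      case False
      hence x: "x = s \<or> x = t" using that by (auto simp: S'_def)
      hence "D' `` {x} = (if x = s then {t} else {s})"
        using D(1) t unfolding D'_def S'_def by auto
      thus ?thesis by simp
    qed
    ultimately show ?thesis by blast
  qed
qed

text \<open>Only edges inside \<open>T\<close> affect two prescribed degrees at once. Once these are
  fixed as \<open>J\<close>, each vertex of \<open>T\<close> tops up independently with edges
  leaving \<open>T\<close>, whose outer ends carry no constraint.\<close>

lemma extend_to_degrees:
  fixes c :: "'a \<Rightarrow> nat"
  assumes fin: "finite V" and E: "E \<subseteq> V \<times> V" "sym E"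
    and TV: "T \<subseteq> V" and J: "J \<subseteq> E \<inter> T \<times> T" "sym J"
    and c: "\<And>t. t \<in> T \<Longrightarrow> deg J t \<le> c t \<and> c t \<le> deg J t + card (E `` {t} - T)"
  shows "\<exists>F \<subseteq> E. sym F \<and> F \<subseteq> T \<times> V \<union> V \<times> T \<and> (\<forall>t\<in>T. deg F t = c t)"
proof -
  have "\<exists>S. S \<subseteq> E `` {t} - T \<and> card S = c t - deg J t" if "t \<in> T" for t
    using c[OF that] by (metis obtain_subset_with_card_n le_diff_conv add.commute)
  then obtain S where S: "\<And>t. t \<in> T \<Longrightarrow> S t \<subseteq> E `` {t} - T \<and> card (S t) = c t - deg J t"
    by metis
  define F where "F = J \<union> (SIGMA t:T. S t) \<union> (SIGMA t:T. S t)\<inverse>"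
  have "F \<subseteq> E" using J S E(2) unfolding F_def by (auto dest: symD)
  moreover have "sym F" using J(2) unfolding F_def sym_def by auto
  moreover have "F \<subseteq> T \<times> V \<union> V \<times> T" using J S E TV unfolding F_def by auto
  moreover have "deg F t = c t" if t: "t \<in> T" for t
  proof -
    have eq: "F `` {t} = J `` {t} \<union> S t" using t S unfolding F_def by auto
    have f: "finite (E `` {t})" using E fin by (meson finite_Image finite_SigmaI finite_subset)
    have "finite (J `` {t})" using f J(1) by (rule_tac finite_subset[OF _ f]) auto
    moreover have "finite (S t)" using f S[OF t] by (meson finite_Diff finite_subset)
    moreover have "J `` {t} \<inter> S t = {}" using J(1) S[OF t] by auto
    ultimately have "deg F t = deg J t + card (S t)" by (simp add: eq card_Un_disjoint)
    thus ?thesis using S[OF t] c[OF t] by simp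
  qed
  ultimately show ?thesis by blast
qed

text \<open>If \<open>T\<close> has at most \<open>a + 1\<close> vertices, all inner edges can be
  kept and every vertex topped up to \<open>a\<close>. With \<open>a + 2\<close> vertices, one
  adjacent to all others in \<open>T\<close> has \<open>a + 1\<close> inner edges: it either gains
  an edge leaving \<open>T\<close> and ends at \<open>a + 2\<close>, or loses an inner edge and ends
  at \<open>a\<close>. Vertices of \<open>Z\<close> have no edge leaving \<open>T\<close>, so only
  the second is open to them.\<close>

lemma small_set_degrees:
  assumes fin: "finite V" and E: "E \<subseteq> V \<times> V" "sym E" "irrefl E"
    and TV: "T \<subseteq> V" and cT: "card T \<le> a + 2"
    and dega: "\<And>t. t \<in> T \<Longrightarrow> a \<le> deg E t"
    and Z: "Z = {z \<in> T. E `` {z} = T - {z}}"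
    and good: "\<not> (card T = a + 2 \<and> odd (card Z) \<and> (\<forall>t\<in>T - Z. deg E t = a))"
  shows "\<exists>F \<subseteq> E. sym F \<and> F \<subseteq> T \<times> V \<union> V \<times> T \<and> (\<forall>t\<in>T. deg F t \<in> {a, a + 2})"
proof -
  have finT: "finite T" using fin TV finite_subset by blast
  have fE: "finite (E `` {t})" for t using E fin by (meson finite_Image finite_SigmaI finite_subset)
  have split: "deg E t = card (E `` {t} \<inter> T) + card (E `` {t} - T)" for t
    using card_Un_disjoint[of "E `` {t} \<inter> T" "E `` {t} - T"] fE[of t]
    by (metis Int_Diff_Un Int_Diff_disjoint finite_Diff finite_Int)
  have inT: "card (E `` {t} \<inter> T) \<le> card T - 1" if "t \<in> T" for t
  proof -
    have "E `` {t} \<inter> T \<subseteq> T - {t}" using E(3) by (auto simp: irrefl_def)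
    thus ?thesis using finT that by (metis card_Diff_singleton card_mono finite_Diff)
  qed
  have full: "E `` {t} \<inter> T = T - {t}" if "t \<in> T" "card (E `` {t} \<inter> T) = card T - 1" for t
  proof (rule card_subset_eq)
    show "E `` {t} \<inter> T \<subseteq> T - {t}" using E(3) by (auto simp: irrefl_def)
  qed (use finT that in auto)
  show ?thesis
  proof (cases "card T \<le> a + 1")
    case True
    have "\<exists>F \<subseteq> E. sym F \<and> F \<subseteq> T \<times> V \<union> V \<times> T \<and> (\<forall>t\<in>T. deg F t = a)"
    proof (rule extend_to_degrees[OF fin E(1,2) TV, of "E \<inter> T \<times> T"])
      show "sym (E \<inter> T \<times> T)" using E(2) by (auto simp: sym_def)
      fix t assume t: "t \<in> T"
      have "(E \<inter> T \<times> T) `` {t} = E `` {t} \<inter> T" using t by auto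
      thus "deg (E \<inter> T \<times> T) t \<le> a \<and> a \<le> deg (E \<inter> T \<times> T) t + card (E `` {t} - T)"
        using inT[OF t] True dega[OF t] split[of t] by simp
    qed auto
    thus ?thesis by blast
  next
    case False
    hence cT: "card T = a + 2" using cT by simp
    have finZ: "finite Z" using finT Z by simp
    \<comment> \<open>Vertices of \<open>Z\<close> cannot reach \<open>a + 2\<close>, so each must lose one of its \<open>a + 1\<close> edges; an unpaired
      one takes an edge to some \<open>t\<close> outside \<open>Z\<close> that has an edge to spare.\<close>
    obtain S where S: "even (card S)" "Z \<subseteq> S" "S \<subseteq> T" "\<And>t. t \<in> S - Z \<Longrightarrow> deg E t \<ge> a + 1"
      "\<And>s t. s \<in> S - Z \<Longrightarrow> t \<in> S - Z \<Longrightarrow> s = t"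
    proof (cases "even (card Z)")
      case True
      thus ?thesis using that[of Z] Z by auto
    next
      case False
      then obtain t where t: "t \<in> T - Z" "deg E t \<noteq> a" using good cT by auto
      show ?thesis
        by (rule that[of "insert t Z"])
          (use t dega[of t] False finZ Z in auto)
    qed
    have finS: "finite S" using S finT finite_subset by blast
    obtain D where D: "D \<subseteq> S \<times> S" "sym D" "irrefl D" "\<forall>s\<in>S. deg D s = 1"
      using ex_perfect_matching[OF finS S(1)] by blast
    \<comment> \<open>\<open>S - Z\<close> has at most one element, so every pair of the matching
      meets \<open>Z\<close>, whose vertices are adjacent to all of \<open>T\<close>. An arbitrary
      pairing of \<open>S\<close> therefore consists of edges.\<close>
    have DE: "D \<subseteq> E"
    proof
      fix p assume p: "p \<in> D"
      obtain s t where st: "p = (s, t)" by (cases p)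
      hence "s \<in> S" "t \<in> S" "s \<noteq> t"
        using D(1,3) p by (auto simp: irrefl_def)
      note st = st this
      hence "s \<in> Z \<or> t \<in> Z" using S(5) by blast
      moreover have "(x, y) \<in> E" if "x \<in> Z" "y \<in> S" "x \<noteq> y" for x y
        using that S(3) unfolding Z by auto
      ultimately show "p \<in> E" using st E(2) by (auto dest: symD)
    qed
    define J where "J = E \<inter> T \<times> T - D"
    \<comment> \<open>Removing \<open>D\<close> costs a vertex of \<open>S\<close> one of at most
      \<open>a + 1\<close> inner edges, so it can stop at \<open>a\<close>. Outside
      \<open>S\<close>, the value \<open>a + 2\<close> occurs only with \<open>a + 1\<close> inner
      edges; such a vertex is not in \<open>Z\<close> and has an edge leaving
      \<open>T\<close>.\<close>
    define c where "c t = (if t \<in> S \<or> card (E `` {t} \<inter> T) \<le> a then a else a + 2)" for t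
    have "\<exists>F \<subseteq> E. sym F \<and> F \<subseteq> T \<times> V \<union> V \<times> T \<and> (\<forall>t\<in>T. deg F t = c t)"
    proof (rule extend_to_degrees[OF fin E(1,2) TV, of J])
      show "sym J" using E(2) D(2) by (auto simp: sym_def J_def)
      show "J \<subseteq> E \<inter> T \<times> T" by (auto simp: J_def)
      fix t assume t: "t \<in> T"
      have Jt: "J `` {t} = (E `` {t} \<inter> T) - D `` {t}" using t by (auto simp: J_def)
      show "deg J t \<le> c t \<and> c t \<le> deg J t + card (E `` {t} - T)"
      proof (cases "t \<in> S")
        case True
        have "D `` {t} \<subseteq> E `` {t} \<inter> T" using D(1) S(3) DE by auto
        hence dJ: "deg J t = card (E `` {t} \<inter> T) - 1"
          unfolding Jt using D(4) True fE[of t]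
          by (metis card_Diff_subset finite_Int finite_subset)
        have "card (E `` {t} \<inter> T) \<ge> 1"
          using \<open>D `` {t} \<subseteq> _\<close> D(4) True fE[of t] by (metis card_mono finite_Int)
        moreover have "deg E t \<ge> a + 1"
        proof (cases "t \<in> Z")
          case True
          hence "E `` {t} = T - {t}" by (simp add: Z)
          thus ?thesis using cT t finT by simp
        qed (use S(4) True in auto)
        ultimately show ?thesis using dJ inT[OF t] cT split[of t] True unfolding c_def by simp linarith
      next
        case False
        hence "D `` {t} = {}" using D(1) by auto
        hence dJ: "deg J t = card (E `` {t} \<inter> T)" unfolding Jt by simp
        show ?thesis
        proof (cases "card (E `` {t} \<inter> T) \<le> a")
          case True
          thus ?thesis using dJ dega[OF t] split[of t] by (simp add: c_def)
        next
          case no: False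
          hence c1: "card (E `` {t} \<inter> T) = a + 1" using inT[OF t] cT by simp
          hence "E `` {t} \<inter> T = T - {t}" using full[OF t] cT by simp
          moreover have "t \<notin> Z" using False S by auto
          ultimately have "E `` {t} - T \<noteq> {}" using t unfolding Z by auto
          hence "card (E `` {t} - T) \<ge> 1" using fE[of t] by (simp add: Suc_le_eq card_gt_0_iff)
          thus ?thesis using c1 dJ False by (simp add: c_def)
        qed
      qed
    qed
    then obtain F where F: "F \<subseteq> E" "sym F" "F \<subseteq> T \<times> V \<union> V \<times> T" "\<forall>t\<in>T. deg F t = c t" by blast
    moreover have "\<forall>t\<in>T. deg F t \<in> {a, a + 2}" using F(4) by (auto simp: c_def)
    ultimately show ?thesis by blast
  qed
qed

section \<open>Choosing the edges at \<open>M\<close>\<close>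

lemma sum_deg_le:
  assumes "finite H" "sym H" "finite X" "finite Y" "\<And>x. x \<in> X \<Longrightarrow> H `` {x} \<subseteq> Y"
  shows "(\<Sum>x\<in>X. deg H x) \<le> (\<Sum>y\<in>Y. deg H y)"
proof -
  have f: "finite (H `` {x})" for x using assms(1) by (simp add: finite_Image)
  have "(\<Sum>x\<in>X. deg H x) = card (SIGMA x:X. H `` {x})" using assms f by (simp add: card_SigmaI)
  also have "\<dots> = card ((SIGMA x:X. H `` {x})\<inverse>)" by simp
  also have "\<dots> \<le> card (SIGMA y:Y. H `` {y})"
    using assms f by (intro card_mono finite_SigmaI) (auto dest: symD)
  also have "\<dots> = (\<Sum>y\<in>Y. deg H y)" using assms f by (simp add: card_SigmaI)
  finally show ?thesis .
qed

text \<open>New edges at \<open>w\<close> avoid \<open>M\<close>, so settled degrees never change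
  again, and avoid vertices that have reached \<open>a + 2\<close>, so the upper bound survives. At
  most \<open>2 * k\<close> vertices are thus forbidden, and degree \<open>a + 2 * k\<close> leaves
  enough room for the at most \<open>a\<close> edges wanted.\<close>

lemma greedy_extension:
  assumes fin: "finite V" and E: "E \<subseteq> V \<times> V" "sym E" "irrefl E"
    and a: "1 \<le> a" and TM: "T \<subseteq> M" "M \<subseteq> V" and k: "card M \<le> k"
    and F0: "F0 \<subseteq> E" "sym F0" "F0 \<subseteq> T \<times> V \<union> V \<times> T"
      "\<forall>t\<in>T. deg F0 t \<in> {a, a + 2}" "\<forall>v\<in>V. deg F0 v \<le> a + 2"
    and large: "\<And>w. w \<in> M - T \<Longrightarrow> a + 2 * k \<le> deg E w"
  shows "\<exists>F \<subseteq> E. sym F \<and> F \<subseteq> M \<times> V \<union> V \<times> M \<and> (\<forall>t\<in>M. deg F t \<in> {a, a + 2}) \<and>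
    (\<forall>v\<in>V. deg F v \<le> a + 2)"
proof -
  have finM: "finite M" using fin TM(2) by (rule finite_subset[rotated])
  have finT: "finite T" using finM TM(1) by (rule finite_subset[rotated])
  have finE: "finite E" using fin E by (meson finite_SigmaI finite_subset)
  have "\<exists>F \<subseteq> E. sym F \<and> F \<subseteq> (T \<union> W) \<times> V \<union> V \<times> (T \<union> W) \<and>
    (\<forall>t\<in>T \<union> W. deg F t \<in> {a, a + 2}) \<and> (\<forall>v\<in>V. deg F v \<le> a + 2)"
    if "finite W" "W \<subseteq> M - T" for W
    using that
  proof (induction W rule: finite_induct)
    case empty
    show ?case using F0 by (intro exI[of _ F0]) auto
  next
    case (insert w W)
    then obtain F where F: "F \<subseteq> E" "sym F" "F \<subseteq> (T \<union> W) \<times> V \<union> V \<times> (T \<union> W)"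
      "\<forall>t\<in>T \<union> W. deg F t \<in> {a, a + 2}" "\<forall>v\<in>V. deg F v \<le> a + 2" by auto
    have w: "w \<in> M" "w \<notin> T" "w \<notin> W" "W \<subseteq> M" using insert by auto
    have finF: "finite F" using F finE finite_subset by blast
    have fF: "finite (F `` {x})" for x using finF by (simp add: finite_Image)
    have fE: "finite (E `` {x})" for x using finE by (simp add: finite_Image)
    \<comment> \<open>Each saturated vertex absorbs \<open>a + 2\<close> edges coming from \<open>T \<union> W\<close>, so there are at most \<open>card M\<close>.\<close>
    define Sat where "Sat = {v \<in> V - M. deg F v = a + 2}"
    have finSat: "finite Sat" using fin by (simp add: Sat_def)
    have out: "F `` {v} \<subseteq> T \<union> W" if "v \<notin> T \<union> W" for v using F(3) that by auto
    have "card Sat * (a + 2) = (\<Sum>v\<in>Sat. deg F v)" by (simp add: Sat_def)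
    also have "\<dots> \<le> (\<Sum>t\<in>T \<union> W. deg F t)"
    proof (rule sum_deg_le[OF finF F(2) finSat])
      show "finite (T \<union> W)" using finT w(4) finM finite_subset by blast
      show "F `` {v} \<subseteq> T \<union> W" if "v \<in> Sat" for v
        using that TM w by (intro out) (auto simp: Sat_def)
    qed
    also have "\<dots> \<le> (\<Sum>t\<in>T \<union> W. a + 2)" using F(5) TM w by (intro sum_mono) auto
    also have "\<dots> = card (T \<union> W) * (a + 2)" by simp
    finally have "card Sat \<le> card (T \<union> W)" by (simp only: mult_le_cancel2)
    also have "\<dots> \<le> card M" using finM TM w by (intro card_mono) auto
    finally have satk: "card Sat \<le> k" using k by (rule order_trans)
    \<comment> \<open>Edges chosen earlier may already give \<open>w\<close> any degree up to
      \<open>a + 2\<close>; above \<open>a\<close>, one more edge is wanted exactly at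
      \<open>a + 1\<close>.\<close>
    define c where "c = (if deg F w \<le> a then a - deg F w else (deg F w - a) mod 2)"
    have wV: "w \<in> V" using w TM by auto
    have ge: "a + 2 * k \<le> deg E w" using large w by simp
    have "card (M \<union> Sat) \<le> k + k" using card_Un_le[of M Sat] k satk by linarith
    moreover have "deg E w - card (M \<union> Sat) \<le> card (E `` {w} - (M \<union> Sat))"
      using finM finSat by (intro diff_card_le_card_Diff) auto
    ultimately have "a \<le> card (E `` {w} - (M \<union> Sat))" using ge by linarith
    moreover have "c \<le> a"
      using a mod_less_divisor[of 2 "deg F w - a"] unfolding c_def by (cases "deg F w \<le> a") simp_all
    ultimately obtain S where S: "S \<subseteq> E `` {w} - (M \<union> Sat)" "card S = c"
      using obtain_subset_with_card_n by (metis order_trans)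
    have finS: "finite S" using S fE[of w] by (meson finite_Diff finite_subset)
    define F' where "F' = F \<union> {w} \<times> S \<union> S \<times> {w}"
    have SV: "S \<subseteq> V" "S \<inter> M = {}" "S \<inter> Sat = {}" using S(1) E(1) by auto
    have dw: "deg F' w = deg F w + c"
    proof -
      have "F' `` {w} = F `` {w} \<union> S" using SV w unfolding F'_def by auto
      moreover have "F `` {w} \<inter> S = {}" using out[of w] w(2-4) SV(2) TM(1) by blast
      ultimately show ?thesis using S(2) fF finS by (simp add: card_Un_disjoint)
    qed
    have dS: "deg F' v = deg F v + 1" if "v \<in> S" for v
    proof -
      have "F' `` {v} = insert w (F `` {v})" using SV w that unfolding F'_def by auto
      moreover have "w \<notin> F `` {v}" using out[of v] w(2-4) SV(2) that TM(1) by blast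
      ultimately show ?thesis using fF by simp
    qed
    have d: "deg F' v = deg F v" if "v \<notin> S" "v \<noteq> w" for v
    proof -
      have "F' `` {v} = F `` {v}" using that unfolding F'_def by auto
      thus ?thesis by simp
    qed
    have uw: "deg F w \<le> a + 2" using F(5) wV by blast
    have dw': "deg F' w \<in> {a, a + 2}"
    proof (cases "deg F w \<le> a")
      case False
      hence "deg F w = a + 1 \<or> deg F w = a + 2" using uw by linarith
      thus ?thesis unfolding dw c_def by auto
    qed (simp add: dw c_def)
    have "F' \<subseteq> E" using F(1) S(1) E(2) unfolding F'_def by (auto dest: symD)
    moreover have "sym F'" using F(2) unfolding F'_def sym_def by auto
    moreover have "F' \<subseteq> (T \<union> insert w W) \<times> V \<union> V \<times> (T \<union> insert w W)"
      using F(3) SV wV unfolding F'_def by auto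
    moreover have "deg F' t \<in> {a, a + 2}" if "t \<in> T \<union> insert w W" for t
    proof (cases "t = w")
      case False
      have "t \<notin> S" using that SV w TM by auto
      thus ?thesis using d[of t] False F(4) that by auto
    qed (use dw' in simp)
    moreover have "deg F' v \<le> a + 2" if v: "v \<in> V" for v
    proof -
      consider "v = w" | "v \<in> S" | "v \<notin> S" "v \<noteq> w" by blast
      thus ?thesis
      proof cases
        case 1 thus ?thesis using dw' by auto
      next
        case 2
        hence "deg F v \<noteq> a + 2" using SV v by (auto simp: Sat_def)
        hence "deg F v < a + 2" using F(5) v by (meson le_neq_implies_less)
        thus ?thesis using dS[OF 2] by simp
      next
        case 3 thus ?thesis using d[of v] F(5) v by simp
      qed
    qed
    ultimately show ?case by (intro exI[of _ F']) auto
  qed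
  from this[of "M - T"] have "\<exists>F \<subseteq> E. sym F \<and> F \<subseteq> (T \<union> (M - T)) \<times> V \<union> V \<times> (T \<union> (M - T)) \<and>
    (\<forall>t\<in>T \<union> (M - T). deg F t \<in> {a, a + 2}) \<and> (\<forall>v\<in>V. deg F v \<le> a + 2)"
    using finM by simp
  moreover have "T \<union> (M - T) = M" using TM by auto
  ultimately show ?thesis by (simp only:)
qed

section \<open>An f-factor of a dense graph, for \<open>f\<close> close to the constant
  \<open>a\<close>\<close>

lemma card_insert_Diff_le:
  assumes "finite A" "y \<in> A"
  shows "card (insert v (A - {y})) \<le> card A"
proof (rule card_insert_le_m1)
  show "0 < card A" using assms card_gt_0_iff by blast
qed (use assms in simp)

text \<open>A subgraph \<open>H\<close> with the most edges under the cap \<open>f\<close> attains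
  it. Otherwise parity supplies two deficient places \<open>v\<close> and \<open>w\<close>. Let
  \<open>X\<close> and \<open>Y\<close> be their neighbours in \<open>G\<close> that are not
  neighbours in \<open>H\<close>. These are saturated, and no edge of \<open>H\<close> joins
  \<open>X\<close> to \<open>Y\<close>, so the edges of \<open>H\<close> at \<open>X\<close> end in
  \<open>B - Y\<close>. As \<open>f\<close> falls short of \<open>a\<close> by at most
  \<open>L\<close> in total, \<open>a * card X - L \<le> a * (card B - card Y)\<close>; but minimum
  degree above half of \<open>card B\<close> makes \<open>card X + card Y\<close> larger than this
  allows.\<close>

lemma ex_f_factor:
  fixes f :: "'a \<Rightarrow> nat"
  assumes fin: "finite B" and G: "G \<subseteq> B \<times> B" "sym G" "irrefl G"
    and fa: "\<And>v. v \<in> B \<Longrightarrow> f v \<le> a" and ev: "even (\<Sum>v\<in>B. f v)"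
    and L: "(\<Sum>v\<in>B. a - f v) \<le> L"
    and m: "\<And>v. v \<in> B \<Longrightarrow> m \<le> 2 * deg G v"
    and big: "L + a * (card B + 2 * a) < a * (m + 2)"
  shows "\<exists>H \<subseteq> G. sym H \<and> (\<forall>v\<in>B. deg H v = f v)"
proof -
  define C where "C = {H. H \<subseteq> G \<and> sym H \<and> (\<forall>v\<in>B. deg H v \<le> f v)}"
  have finG: "finite G" using fin G by (meson finite_SigmaI finite_subset)
  have "C \<subseteq> Pow G" by (auto simp: C_def)
  hence finC: "finite C" using finG by (meson finite_Pow_iff finite_subset)
  have "{} \<in> C" by (auto simp: C_def sym_def)
  hence "Max (card ` C) \<in> card ` C" using finC by (intro Max_in) auto
  then obtain H where HC: "H \<in> C" and "card H = Max (card ` C)" by auto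
  hence max: "card H' \<le> card H" if "H' \<in> C" for H' using that finC by simp
  have H: "H \<subseteq> G" "sym H" "\<And>v. v \<in> B \<Longrightarrow> deg H v \<le> f v" using HC by (auto simp: C_def)
  have finH: "finite H" using H finG finite_subset by blast
  have fH: "finite (H `` {v})" for v using finH by (simp add: finite_Image)
  have fG: "finite (G `` {v})" for v using finG by (simp add: finite_Image)
  have irH: "irrefl H" using H(1) G(3) by (auto simp: irrefl_def)
  have HB: "H \<subseteq> B \<times> B" using H G by auto
  show ?thesis
  proof (rule ccontr)
    assume "\<not> ?thesis"
    then obtain v where v: "v \<in> B" "deg H v < f v" using H by (metis le_neq_implies_less)
    \<comment> \<open>If \<open>v\<close> alone is deficient, both sums being even makes its
      shortfall even, hence at least two, and \<open>w = v\<close> serves.\<close>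
    obtain w where w: "w \<in> B" "deg H w < f w" "v = w \<Longrightarrow> deg H v + 2 \<le> f v"
    proof (cases "\<exists>w\<in>B. w \<noteq> v \<and> deg H w < f w")
      case True
      thus ?thesis using that by blast
    next
      case False
      hence eq: "deg H w = f w" if "w \<in> B - {v}" for w using that H(3) by (metis DiffD1 DiffD2 insertI1 le_neq_implies_less)
      have "even (\<Sum>w\<in>B. deg H w)" by (rule even_sum_deg[OF fin HB H(2) irH])
      moreover have "(\<Sum>w\<in>B. deg H w) = deg H v + (\<Sum>w\<in>B - {v}. f w)"
        using v fin eq by (simp add: sum.remove)
      moreover have "(\<Sum>w\<in>B. f w) = f v + (\<Sum>w\<in>B - {v}. f w)"
        using v fin by (simp add: sum.remove)
      ultimately have "even (f v + deg H v)" using ev by (metis even_add)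
      hence "f v \<noteq> deg H v + 1" by auto
      thus ?thesis using v by (intro that[of v]) auto
    qed
    have noaug: False if xy: "(x, y) \<in> G - H" "deg H x < f x" "deg H y < f y" for x y
    proof -
      define H' where "H' = H \<union> {(x, y), (y, x)}"
      have ne: "x \<noteq> y" using xy G(3) by (auto simp: irrefl_def)
      have yx: "(y, x) \<notin> H" using xy H(2) by (auto dest: symD)
      have "deg H' u \<le> f u" if "u \<in> B" for u
      proof -
        have "H' `` {u} = (if u = x then insert y (H `` {u}) else if u = y then insert x (H `` {u}) else H `` {u})"
          using ne by (auto simp: H'_def)
        thus ?thesis using H(3)[OF that] xy yx fH by auto
      qed
      hence "H' \<in> C" using H xy G(2) by (auto simp: C_def H'_def sym_def)
      hence "card H' \<le> card H" by (rule max)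
      moreover have "card H < card H'"
        using xy finH by (intro psubset_card_mono) (auto simp: H'_def)
      ultimately show False by simp
    qed
    define X where "X = G `` {v} - H `` {v}"
    define Y where "Y = G `` {w} - H `` {w}"
    have XB: "X \<subseteq> B" "Y \<subseteq> B" using G by (auto simp: X_def Y_def)
    have finX: "finite X" "finite Y" using XB fin finite_subset by auto
    have satX: "deg H x = f x" if "x \<in> X" for x
    proof (rule ccontr)
      assume "deg H x \<noteq> f x"
      hence "deg H x < f x" using H(3)[of x] XB(1) that by auto
      thus False using noaug[of v x] that v by (auto simp: X_def)
    qed
    \<comment> \<open>Otherwise replacing \<open>xy\<close> by \<open>vx\<close> and \<open>wy\<close> gives a larger \<open>H\<close>.\<close>
    have noXY: "(x, y) \<notin> H" if xy: "x \<in> X" "y \<in> Y" for x y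
    proof
      assume xyH: "(x, y) \<in> H"
      have yxH: "(y, x) \<in> H" using xyH H(2) by (auto dest: symD)
      \<comment> \<open>\<open>x = w\<close> or \<open>y = v\<close> would turn \<open>xy\<close>
        into \<open>wy\<close> or \<open>vx\<close>, which are not in \<open>H\<close>; the other
        coincidences would be loops. \<open>X\<close> and \<open>Y\<close> may overlap, and
        \<open>v = w\<close> is possible.\<close>
      have ne: "x \<noteq> y" "x \<noteq> v" "y \<noteq> w" "x \<noteq> w" "y \<noteq> v"
        using xy xyH yxH irH G(3) by (auto simp: X_def Y_def irrefl_def)
      have n: "(v, x) \<in> G" "(v, x) \<notin> H" "(w, y) \<in> G" "(w, y) \<notin> H" "(x, v) \<notin> H" "(y, w) \<notin> H"
        "(x, v) \<in> G" "(y, w) \<in> G"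
        using xy H(2) G(2) by (auto simp: X_def Y_def dest: symD)
      define N where "N = {(v, x), (x, v), (w, y), (y, w)}"
      define R where "R = {(x, y), (y, x)}"
      define H' where "H' = (H - R) \<union> N"
      have "deg H' u \<le> f u" if u: "u \<in> B" for u
      proof -
        consider "u = x" | "u = y" | "u = v" "v \<noteq> w" | "u = w" "v \<noteq> w" | "u = v" "v = w"
          | "u \<notin> {x, y, v, w}" by blast
        thus ?thesis
        proof cases
          case 1
          hence "H' `` {u} = insert v (H `` {u} - {y})" using ne by (auto simp: H'_def N_def R_def)
          moreover have "card (insert v (H `` {u} - {y})) \<le> deg H u"
            using 1 xyH fH[of u] by (intro card_insert_Diff_le) auto
          ultimately show ?thesis using H(3)[OF u] by simp
        next
          case 2
          hence "H' `` {u} = insert w (H `` {u} - {x})" using ne by (auto simp: H'_def N_def R_def)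
          moreover have "card (insert w (H `` {u} - {x})) \<le> deg H u"
            using 2 yxH fH[of u] by (intro card_insert_Diff_le) auto
          ultimately show ?thesis using H(3)[OF u] by simp
        next
          case 3
          hence "H' `` {u} = insert x (H `` {u})" using ne by (auto simp: H'_def N_def R_def)
          thus ?thesis using 3 v fH[of u] card_insert_le_m1[of "f u" "H `` {u}" x] by auto
        next
          case 4
          hence "H' `` {u} = insert y (H `` {u})" using ne by (auto simp: H'_def N_def R_def)
          thus ?thesis using 4 w fH[of u] card_insert_le_m1[of "f u" "H `` {u}" y] by auto
        next
          case 5
          hence "H' `` {u} = insert x (insert y (H `` {u}))" using ne by (auto simp: H'_def N_def R_def)
          hence "deg H' u \<le> deg H u + 2"
            using card_insert_if[OF fH[of u], of y]
              card_insert_if[OF finite.insertI[OF fH[of u]], of x y] by (auto split: if_splits)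
          thus ?thesis using 5 w by auto
        next
          case 6
          hence "H' `` {u} = H `` {u}" by (auto simp: H'_def N_def R_def)
          thus ?thesis using H(3)[OF u] by simp
        qed
      qed
      moreover have "H' \<subseteq> G" using H(1) n by (auto simp: H'_def N_def)
      moreover have "sym H'" using H(2) by (auto simp: H'_def N_def R_def sym_def)
      ultimately have "H' \<in> C" by (simp add: C_def)
      hence le: "card H' \<le> card H" by (rule max)
      have "card N = 4" using ne by (auto simp: N_def)
      moreover have "card R = 2" using ne by (auto simp: R_def)
      moreover have "card H' = card (H - R) + card N"
        unfolding H'_def using finH n by (intro card_Un_disjoint) (auto simp: N_def)
      moreover have "card (H - R) = card H - card R"
        using xyH yxH by (intro card_Diff_subset) (auto simp: R_def)
      moreover have "card R \<le> card H"
        using xyH yxH finH by (intro card_mono) (auto simp: R_def)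
      ultimately show False using le by linarith
    qed
    have "a * card X = (\<Sum>x\<in>X. f x + (a - f x))"
      using fa XB by (simp add: subset_iff)
    also have "\<dots> = (\<Sum>x\<in>X. deg H x) + (\<Sum>x\<in>X. a - f x)"
      using satX by (simp add: sum.distrib)
    also have "(\<Sum>x\<in>X. a - f x) \<le> L"
      using L sum_mono2[OF fin XB(1), of "\<lambda>x. a - f x"] by simp
    also have "(\<Sum>x\<in>X. deg H x) \<le> (\<Sum>y\<in>B - Y. deg H y)"
      by (rule sum_deg_le[OF finH H(2)]) (use finX fin noXY HB in auto)
    also have "\<dots> \<le> (\<Sum>y\<in>B - Y. a)"
      using H(3) fa by (intro sum_mono) (meson DiffD1 order_trans)
    also have "\<dots> = a * (card B - card Y)"
      using finX XB by (simp add: card_Diff_subset)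
    finally have "a * card X \<le> a * (card B - card Y) + L" by simp
    moreover have "card Y \<le> card B" using XB fin card_mono by blast
    then obtain r where "card B = card Y + r" using le_Suc_ex by blast
    ultimately have XY: "a * (card X + card Y) \<le> a * card B + L"
      by (simp add: distrib_left)
    \<comment> \<open>\<open>deg H v < f v \<le> a\<close> means that \<open>H\<close> uses at most
      \<open>a - 1\<close> edges at \<open>v\<close>; this strictness yields the \<open>+ 2\<close>,
      and likewise at \<open>w\<close>.\<close>
    moreover have "m + 2 \<le> 2 * card X + 2 * a"
    proof -
      have "card X = deg G v - deg H v"
        unfolding X_def using H(1) fH by (intro card_Diff_subset) auto
      thus ?thesis using m[OF v(1)] v fa[OF v(1)] by linarith
    qed
    moreover have "m + 2 \<le> 2 * card Y + 2 * a"
    proof -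
      have "card Y = deg G w - deg H w"
        unfolding Y_def using H(1) fH by (intro card_Diff_subset) auto
      thus ?thesis using m[OF w(1)] w fa[OF w(1)] by linarith
    qed
    ultimately have "m + 2 \<le> card X + card Y + 2 * a" by linarith
    hence "a * (m + 2) \<le> a * (card X + card Y + 2 * a)" by (intro mult_le_mono2)
    also have "\<dots> \<le> L + a * (card B + 2 * a)"
      using XY by (simp add: algebra_simps)
    finally show False using big by simp
  qed
qed

text \<open>Once the edges at \<open>M\<close> are chosen, the graph on \<open>B = V - M\<close> has
  to supply the residual demand \<open>f\<close>. All edges of \<open>F\<close> touch
  \<open>M\<close>, so \<open>f\<close> falls short of \<open>a\<close> only by what
  \<open>M\<close> has sent into \<open>B\<close>, at most \<open>(a + 2) * card M\<close> in total;
  this is the \<open>L\<close> of \<open>ex_f_factor\<close>.\<close>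

lemma two_degree_factor:
  assumes fin: "finite V" and E: "E \<subseteq> V \<times> V" "sym E" "irrefl E"
    and a: "2 \<le> a" and ev: "even (card V * a)"
    and TM: "T \<subseteq> M" "M \<subseteq> V" and cT: "card T \<le> a + 2" and cM: "card M \<le> 2 * a + 6"
    and dega: "\<And>v. v \<in> V \<Longrightarrow> a \<le> deg E v"
    and degT: "\<And>v. v \<in> V - T \<Longrightarrow> 5 * a + 12 \<le> deg E v"
    and degM: "\<And>v. v \<in> V - M \<Longrightarrow> card V + 6 * a + 23 \<le> 2 * deg E v"
    and good: "\<not> (card T = a + 2 \<and> odd (card {z \<in> T. E `` {z} = T - {z}}) \<and>
      (\<forall>t\<in>T. E `` {t} \<noteq> T - {t} \<longrightarrow> deg E t = a))"
  shows "\<exists>F \<subseteq> E. sym F \<and> (\<forall>v\<in>V. deg F v \<in> {a, a + 2})"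
proof -
  have finM: "finite M" using fin TM(2) by (rule finite_subset[rotated])
  have finT: "finite T" using finM TM(1) by (rule finite_subset[rotated])
  have fE: "finite (E `` {v})" for v using E fin by (meson finite_Image finite_SigmaI finite_subset)
  obtain F0 where F0: "F0 \<subseteq> E" "sym F0" "F0 \<subseteq> T \<times> V \<union> V \<times> T" "\<forall>t\<in>T. deg F0 t \<in> {a, a + 2}"
    using small_set_degrees[OF fin E _ cT _ refl] TM dega good by blast
  have "deg F0 v \<le> a + 2" if "v \<in> V" for v
  proof (cases "v \<in> T")
    case False
    hence "F0 `` {v} \<subseteq> T" using F0(3) by auto
    hence "deg F0 v \<le> card T" using finT card_mono by blast
    thus ?thesis using cT by simp
  qed (use F0 in auto)
  \<comment> \<open>With \<open>k = 2 * a + 6\<close>, the greedy step asks for degree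
    \<open>a + 2 * k = 5 * a + 12\<close>, the threshold that defines \<open>T\<close>.\<close>
  moreover have "a + 2 * (2 * a + 6) \<le> deg E w" if "w \<in> M - T" for w
    using degT[of w] that TM by auto
  ultimately obtain F where F: "F \<subseteq> E" "sym F" "F \<subseteq> M \<times> V \<union> V \<times> M"
    "\<forall>t\<in>M. deg F t \<in> {a, a + 2}" "\<forall>v\<in>V. deg F v \<le> a + 2"
    using greedy_extension[OF fin E _ TM cM F0] a by auto
  have finF: "finite F" using F(1) E(1) fin by (meson finite_SigmaI finite_subset)
  define B where "B = V - M"
  have finB: "finite B" using fin by (simp add: B_def)
  define G where "G = E \<inter> B \<times> B"
  define f where "f v = (if deg F v \<le> a then a - deg F v else (deg F v - a) mod 2)" for v
  have tot: "deg F v + f v \<in> {a, a + 2}" if "v \<in> V" for v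
  proof (cases "deg F v \<le> a")
    case False
    hence "deg F v = a + 1 \<or> deg F v = a + 2" using F(5) that by (metis add_2_eq_Suc' le_Suc_eq Suc_eq_plus1 add_Suc_right)
    thus ?thesis unfolding f_def by auto
  qed (simp add: f_def)
  have VMB: "(\<Sum>v\<in>V. g v) = (\<Sum>v\<in>M. g v) + (\<Sum>v\<in>B. g v)" for g :: "'a \<Rightarrow> nat"
    unfolding B_def using sum.subset_diff[OF TM(2) fin, of g] by simp
  have "\<exists>H \<subseteq> G. sym H \<and> (\<forall>v\<in>B. deg H v = f v)"
  proof (rule ex_f_factor[OF finB, where a = a and L = "(a + 2) * card M" and m = "card V + 6 * a + 23 - 2 * card M"])
    show "G \<subseteq> B \<times> B" "sym G" "irrefl G" using E by (auto simp: G_def sym_def irrefl_def)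
    show "f v \<le> a" for v
      using a mod_less_divisor[of 2 "deg F v - a"] unfolding f_def by (cases "deg F v \<le> a") simp_all
    \<comment> \<open>All final degrees are congruent to \<open>a\<close>, so modulo 2 the residual
      demand is \<open>card V * a\<close> plus the even degree sum of \<open>F\<close>.\<close>
    have "even (\<Sum>v\<in>V. deg F v)"
      using F E by (intro even_sum_deg[OF fin]) (auto simp: irrefl_def)
    moreover have "even ((\<Sum>v\<in>M. deg F v) + card M * a)"
    proof -
      have "(\<Sum>v\<in>M. deg F v) + card M * a = (\<Sum>v\<in>M. deg F v + a)" by (simp add: sum.distrib)
      moreover have "even \<dots>"
      proof (rule dvd_sum)
        fix v assume "v \<in> M"
        hence "deg F v = a \<or> deg F v = a + 2" using F(4) by blast
        thus "even (deg F v + a)" by (elim disjE) simp_all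
      qed
      ultimately show ?thesis by simp
    qed
    moreover have "even ((\<Sum>v\<in>B. deg F v) + (\<Sum>v\<in>B. f v) + card B * a)"
    proof -
      have "(\<Sum>v\<in>B. deg F v) + (\<Sum>v\<in>B. f v) + card B * a = (\<Sum>v\<in>B. deg F v + f v + a)"
        by (simp add: sum.distrib)
      moreover have "even \<dots>"
      proof (rule dvd_sum)
        fix v assume "v \<in> B"
        hence "deg F v + f v = a \<or> deg F v + f v = a + 2" using tot[of v] by (simp add: B_def)
        thus "even (deg F v + f v + a)" by (elim disjE) simp_all
      qed
      ultimately show ?thesis by simp
    qed
    moreover have "card V = card M + card B" using VMB[of "\<lambda>_. 1"] by simp
    ultimately show "even (\<Sum>v\<in>B. f v)" using ev VMB[of "deg F"] by (simp add: algebra_simps) 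
    have "(\<Sum>v\<in>B. a - f v) \<le> (\<Sum>v\<in>B. deg F v)"
      by (intro sum_mono) (auto simp: f_def)
    also have "\<dots> \<le> (\<Sum>v\<in>M. deg F v)"
      by (rule sum_deg_le[OF finF F(2) finB finM]) (use F(3) in \<open>auto simp: B_def\<close>)
    also have "\<dots> \<le> (\<Sum>v\<in>M. a + 2)" using F(4) by (intro sum_mono) fastforce
    finally show "(\<Sum>v\<in>B. a - f v) \<le> (a + 2) * card M" by (simp add: mult.commute)
  next
    fix v assume v: "v \<in> B"
    have "G `` {v} = E `` {v} - M" using v E by (auto simp: G_def B_def)
    hence "deg E v - card M \<le> deg G v" using diff_card_le_card_Diff[OF finM] by simp
    thus "card V + 6 * a + 23 - 2 * card M \<le> 2 * deg G v" using degM[of v] v by (simp add: B_def)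
  next
    have cV: "card V = card M + card B" using VMB[of "\<lambda>_. 1"] by simp
    \<comment> \<open>After cancellation the required inequality is
      \<open>(2 * a + 2) * card M < a * (4 * a + 25)\<close>; at \<open>card M = 2 * a + 6\<close>
      it amounts to \<open>12 < 9 * a\<close>.\<close>
    have "(2 * a + 2) * card M \<le> (2 * a + 2) * (2 * a + 6)" using cM by (intro mult_le_mono2)
    also have "\<dots> < a * (4 * a + 25)" using a by (simp add: algebra_simps)
    finally have "(2 * a + 2) * card M < a * (4 * a + 25)" .
    moreover have "card V + 6 * a + 23 - 2 * card M + 2 + card M = card B + 6 * a + 25"
      using cV cM by simp
    hence "a * (card V + 6 * a + 23 - 2 * card M + 2) + a * card M = a * (card B + 6 * a + 25)"
      by (metis distrib_left)
    ultimately show "(a + 2) * card M + a * (card B + 2 * a) < a * (card V + 6 * a + 23 - 2 * card M + 2)"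
      by (simp add: algebra_simps)
  qed
  then obtain H where H: "H \<subseteq> G" "sym H" "\<And>v. v \<in> B \<Longrightarrow> deg H v = f v" by blast
  have finH: "finite H" 
    using H(1) finB by (rule_tac finite_subset[of _ "B \<times> B"]) (auto simp: G_def)
  have FB: "F `` {v} \<inter> H `` {v} = {}" for v using F(3) H(1) by (auto simp: G_def B_def)
  have "deg (F \<union> H) v \<in> {a, a + 2}" if v: "v \<in> V" for v
  proof (cases "v \<in> M")
    case True
    hence "(F \<union> H) `` {v} = F `` {v}" using H(1) by (auto simp: G_def B_def)
    thus ?thesis using F(4) True by simp
  next
    case False
    hence "v \<in> B" using v by (simp add: B_def)
    thus ?thesis using deg_Un_disjoint[OF _ _ FB, of v] finF finH H(3) tot[OF v]
      by (simp add: finite_Image)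
  qed
  moreover have "F \<union> H \<subseteq> E" "sym (F \<union> H)"
    using F H by (auto simp: G_def sym_def)
  ultimately show ?thesis by blast
qed

section \<open>Few vertices of low degree\<close>

text \<open>Counts non-adjacent ordered pairs. \<open>A\<close> holds those that start in
  \<open>S\<close>; its converse has as many, and the two overlap only in off-diagonal pairs of
  \<open>S\<close>. Doubled degrees avoid rounding for thresholds near half the order.\<close>

lemma sum_deg_deficient:
  fixes D :: nat
  assumes fin: "finite V" and E: "E \<subseteq> V \<times> V" "sym E" "irrefl E"
    and S: "S \<subseteq> V" and D: "\<And>v. v \<in> S \<Longrightarrow> 2 * deg E v \<le> D"
  shows "int (card E) + int (card S) * (2 * int (card V) - 2 - int D)
    \<le> int (card V) * (int (card V) - 1) + int (card S) * (int (card S) - 1)"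
proof -
  have finS: "finite S" using fin S finite_subset by blast
  have finE: "finite E" using fin E by (meson finite_SigmaI finite_subset)
  have fE: "finite (E `` {v})" for v using finE by (simp add: finite_Image)
  define N where "N = V \<times> V - Id - E"
  have finN: "finite N" using fin by (simp add: N_def)
  have NV: "N \<subseteq> V \<times> V" by (auto simp: N_def)
  have symN: "sym N" using E(2) by (auto simp: N_def sym_def)
  have offdiag: "int (card (X \<times> X - Id)) = int (card X) * (int (card X) - 1)" if "finite X" for X :: "'a set"
  proof -
    have "X \<times> X - Id = X \<times> X - (\<lambda>v. (v, v)) ` X" by auto
    moreover have "card ((\<lambda>v. (v, v)) ` X) = card X" by (intro card_image) (auto simp: inj_on_def)
    moreover have "(\<lambda>v. (v, v)) ` X \<subseteq> X \<times> X" by auto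
    moreover have "card X \<le> card X * card X" by (cases "card X") auto
    ultimately show ?thesis using that
      by (simp add: card_Diff_subset card_cartesian_product of_nat_diff algebra_simps)
  qed
  have "V \<times> V - Id = E \<union> N" using E(1,3) by (auto simp: N_def irrefl_def)
  hence total: "int (card V) * (int (card V) - 1) = int (card E) + int (card N)"
    using offdiag[OF fin] card_Un_disjoint[OF finE finN] by (simp add: N_def)
  define A where "A = N \<inter> S \<times> V"
  have finA: "finite A" using finN by (simp add: A_def)
  have "card (A \<union> A\<inverse>) + card (A \<inter> A\<inverse>) = card A + card (A\<inverse>)"
    using finA by (intro card_Un_Int[symmetric]) auto
  moreover have "card (A\<inverse>) = card A" by simp
  moreover have "card (A \<union> A\<inverse>) \<le> card N"
    using finN symN by (intro card_mono) (auto simp: A_def dest: symD)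
  moreover have "card (A \<inter> A\<inverse>) \<le> card (S \<times> S - Id)"
    using finS by (intro card_mono) (auto simp: A_def N_def)
  ultimately have "2 * int (card A) \<le> int (card N) + int (card S) * (int (card S) - 1)"
    using offdiag[OF finS] by linarith
  moreover have "int (card S) * (2 * int (card V) - 2 - int D) \<le> 2 * int (card A)"
  proof -
    have "A = (SIGMA v:S. N `` {v})" using NV by (auto simp: A_def)
    moreover have "card (SIGMA v:S. N `` {v}) = (\<Sum>v\<in>S. deg N v)"
      using finS finN by (intro card_SigmaI) (auto simp: finite_Image)
    ultimately have "2 * int (card A) = (\<Sum>v\<in>S. 2 * int (deg N v))" by (simp add: sum_distrib_left)
    moreover have "2 * int (card V) - 2 - int D \<le> 2 * int (deg N v)" if v: "v \<in> S" for v
    proof -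
      have vV: "v \<in> V" using v S by auto
      have eq: "V - {v} = E `` {v} \<union> N `` {v}" using E(1,3) vV by (auto simp: N_def irrefl_def)
      have "card V - 1 = card (V - {v})" using vV fin by simp
      also have "\<dots> = deg E v + deg N v"
        unfolding eq using fE finN by (intro card_Un_disjoint) (auto simp: N_def finite_Image)
      finally have "int (card V) - 1 \<le> int (deg E v) + int (deg N v)" by linarith
      thus ?thesis using D[OF v] by linarith
    qed
    ultimately show ?thesis using sum_bounded_below[of S "2 * int (card V) - 2 - int D" "\<lambda>v. 2 * int (deg N v)"]
      by simp
  qed
  ultimately show ?thesis using total by linarith
qed

text \<open>Vertices of such low degree, \<open>a + 3\<close> in number, would miss about
  \<open>(a + 3) * n\<close> edges, more than density permits, where \<open>n = card V\<close>.
  Precisely, they would force \<open>2 * n \<le> 10 * a^2 + 53 * a + 70\<close>.\<close>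

lemma card_low_degree_le:
  assumes fin: "finite V" and E: "E \<subseteq> V \<times> V" "sym E" "irrefl E"
    and a: "2 \<le> a"
    and n: "7 * a\<^sup>2 + 25 * a + 56 \<le> card V"
    and dense: "(int (card V) - int a - 3)\<^sup>2 + int (card V) - 1 \<le> int (card E)"
  shows "card {v \<in> V. deg E v < 5 * a + 12} \<le> a + 2"
proof -
  have aa: "2 * int a \<le> int a * int a" using a by simp
  have n': "7 * (int a * int a) + 25 * int a + 56 \<le> int (card V)"
    using of_nat_mono[OF n, where 'a = int] by (simp add: power2_eq_square)
  show "card {v \<in> V. deg E v < 5 * a + 12} \<le> a + 2"
  proof (rule ccontr)
    assume "\<not> ?thesis"
    hence "a + 3 \<le> card {v \<in> V. deg E v < 5 * a + 12}" by simp
    then obtain S where S: "S \<subseteq> {v \<in> V. deg E v < 5 * a + 12}" "card S = a + 3"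
      by (rule obtain_subset_with_card_n)
    have "int (card E) + int (card S) * (2 * int (card V) - 2 - int (10 * a + 22))
      \<le> int (card V) * (int (card V) - 1) + int (card S) * (int (card S) - 1)"
      using S(1) by (intro sum_deg_deficient[OF fin E]) auto
    thus False using dense aa n' S(2) by (simp add: power2_eq_square algebra_simps)
  qed
qed

text \<open>Each such vertex misses nearly half of the others. With \<open>n = card V\<close>,
  having \<open>2 * a + 7\<close> of them forces
  \<open>3 * n \<le> 15 * a^2 + 110 * a + 202\<close>. The bound with \<open>7 * a^2\<close> refutes
  this from \<open>a = 7\<close> on, the one with \<open>136 * a\<close> for smaller
  \<open>a\<close>.\<close>

lemma card_half_degree_le:
  assumes fin: "finite V" and E: "E \<subseteq> V \<times> V" "sym E" "irrefl E"
    and a: "2 \<le> a"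
    and n1: "2 * a\<^sup>2 + 136 * a + 264 \<le> card V" and n2: "7 * a\<^sup>2 + 25 * a + 56 \<le> card V"
    and dense: "(int (card V) - int a - 3)\<^sup>2 + int (card V) - 1 \<le> int (card E)"
  shows "card {v \<in> V. 2 * deg E v < card V + 6 * a + 23} \<le> 2 * a + 6"
proof -
  have aa: "2 * int a \<le> int a * int a" using a by simp
  have n1': "2 * (int a * int a) + 136 * int a + 264 \<le> int (card V)"
    using of_nat_mono[OF n1, where 'a = int] by (simp add: power2_eq_square)
  have n2': "7 * (int a * int a) + 25 * int a + 56 \<le> int (card V)"
    using of_nat_mono[OF n2, where 'a = int] by (simp add: power2_eq_square)
  show "card {v \<in> V. 2 * deg E v < card V + 6 * a + 23} \<le> 2 * a + 6"
  proof (rule ccontr)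
    assume "\<not> ?thesis"
    hence "2 * a + 7 \<le> card {v \<in> V. 2 * deg E v < card V + 6 * a + 23}" by simp
    then obtain S where S: "S \<subseteq> {v \<in> V. 2 * deg E v < card V + 6 * a + 23}" "card S = 2 * a + 7"
      by (rule obtain_subset_with_card_n)
    have "int (card E) + int (card S) * (2 * int (card V) - 2 - int (card V + 6 * a + 22))
      \<le> int (card V) * (int (card V) - 1) + int (card S) * (int (card S) - 1)"
      using S(1) by (intro sum_deg_deficient[OF fin E]) auto
    thus False using dense aa n1' n2' S(2) by (simp add: power2_eq_square algebra_simps)
  qed
qed

section \<open>The Rayleigh quotient of a relation\<close>

text \<open>The bilinear form of the adjacency matrix. Arcs come in opposite pairs, so an edge
  \<open>uv\<close> contributes \<open>2 * x u * x v\<close> to \<open>bil E x x\<close>.\<close>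

definition bil :: "('a \<times> 'a) set \<Rightarrow> ('a \<Rightarrow> real) \<Rightarrow> ('a \<Rightarrow> real) \<Rightarrow> real" where
  "bil E x y = (\<Sum>p\<in>E. x (fst p) * y (snd p))"

lemma bil_rows:
  assumes "finite V" "E \<subseteq> V \<times> V"
  shows "bil E x y = (\<Sum>u\<in>V. x u * (\<Sum>v\<in>E `` {u}. y v))"
proof -
  have "finite E" using assms by (meson finite_SigmaI finite_subset)
  hence f: "finite (E `` {v})" for v by (simp add: finite_Image)
  have "E = (SIGMA u:V. E `` {u})" using assms by auto
  hence "bil E x y = (\<Sum>p\<in>(SIGMA u:V. E `` {u}). x (fst p) * y (snd p))" by (simp add: bil_def)
  also have "\<dots> = (\<Sum>u\<in>V. \<Sum>v\<in>E `` {u}. x u * y v)"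
    using assms f by (subst sum.Sigma) (auto simp: case_prod_unfold)
  finally show ?thesis by (simp add: sum_distrib_left)
qed

lemma bil_sym:
  assumes "sym E"
  shows "bil E x y = bil E y x"
proof -
  have "bij_betw prod.swap E E"
    using assms by (intro bij_betw_byWitness[where f' = prod.swap]) (auto simp: sym_def)
  from sum.reindex_bij_betw[OF this, of "\<lambda>p. x (fst p) * y (snd p)"]
  show ?thesis by (simp add: bil_def mult.commute)
qed

lemma bil_add_scaled:
  "bil E (\<lambda>v. x v + s * e v) (\<lambda>v. x v + s * e v) =
    bil E x x + s * bil E x e + s * bil E e x + s\<^sup>2 * bil E e e"
  unfolding bil_def
  by (simp add: algebra_simps power2_eq_square sum.distrib sum_distrib_left)

lemma bil_mono:
  assumes "finite E'" "E \<subseteq> E'" "\<And>u v. (u, v) \<in> E' \<Longrightarrow> 0 \<le> x u * y v"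
  shows "bil E x y \<le> bil E' x y"
  unfolding bil_def using assms by (intro sum_mono2) auto

text \<open>Compactness of the set of nonnegative unit vectors. Restricting to them loses nothing:
  passing to absolute values does not decrease the form, so after scaling the bound holds for all
  real vectors.\<close>

lemma ex_rayleigh_maximizer:
  assumes fin: "finite V" and ne: "V \<noteq> {}" and E: "E \<subseteq> V \<times> V"
  obtains x where "\<And>v. v \<in> V \<Longrightarrow> 0 \<le> x v" "(\<Sum>v\<in>V. (x v)\<^sup>2) = 1"
    "\<And>y. bil E y y \<le> bil E x x * (\<Sum>v\<in>V. (y v)\<^sup>2)"
proof -
  have finE: "finite E" using fin E by (meson finite_SigmaI finite_subset)
  \<comment> \<open>Vectors are functions on the whole type, which may be infinite; the value 0
    outside \<open>V\<close> makes the box a product of compact sets.\<close>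
  define S :: "'a \<Rightarrow> real set" where "S v = (if v \<in> V then {0..1} else {0})" for v
  define K where "K = PiE UNIV S \<inter> {x. (\<Sum>v\<in>V. (x v)\<^sup>2) = 1}"
  have co: "continuous_on A (\<lambda>x :: 'a \<Rightarrow> real. x i)" for A i
    by (rule continuous_on_subset[OF continuous_on_product_coordinates]) simp
  have "compactin (product_topology (\<lambda>_. euclidean) UNIV) (PiE UNIV S)"
    by (subst compactin_PiE) (auto simp: S_def)
  hence "compact (PiE UNIV S)" by (simp add: euclidean_product_topology)
  moreover have "closed {x :: 'a \<Rightarrow> real. (\<Sum>v\<in>V. (x v)\<^sup>2) = 1}"
    by (intro closed_Collect_eq continuous_on_sum continuous_on_power co continuous_on_const)
  ultimately have cK: "compact K" unfolding K_def by (rule compact_Int_closed)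
  obtain v0 where v0: "v0 \<in> V" using ne by auto
  have "(\<lambda>v. if v = v0 then 1 else 0) \<in> K"
  proof -
    have "(\<Sum>v\<in>V. (if v = v0 then 1 else 0 :: real)\<^sup>2) = (\<Sum>v\<in>V. if v = v0 then 1 else 0)"
      by (intro sum.cong) auto
    thus ?thesis using v0 fin by (auto simp: K_def S_def)
  qed
  hence neK: "K \<noteq> {}" by blast
  have contK: "continuous_on K (\<lambda>x. bil E x x)"
    unfolding bil_def by (intro continuous_on_sum continuous_on_mult co)
  obtain x where x: "x \<in> K" "\<And>y. y \<in> K \<Longrightarrow> bil E y y \<le> bil E x x"
    using continuous_attains_sup[OF cK neK contK] by blast
  show ?thesis
  proof (rule that)
    show "0 \<le> x v" if "v \<in> V" for v
      using x(1) that by (auto simp: K_def S_def PiE_def Pi_def split: if_splits)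
    show "(\<Sum>v\<in>V. (x v)\<^sup>2) = 1" using x(1) by (simp add: K_def)
    fix y :: "'a \<Rightarrow> real"
    define s where "s = (\<Sum>v\<in>V. (y v)\<^sup>2)"
    have s0: "0 \<le> s" unfolding s_def by (intro sum_nonneg) auto
    show "bil E y y \<le> bil E x x * (\<Sum>v\<in>V. (y v)\<^sup>2)"
    proof (cases "s = 0")
      case True
      hence "y v = 0" if "v \<in> V" for v
        using that fin unfolding s_def by (subst (asm) sum_nonneg_eq_0_iff) auto
      hence "bil E y y = 0" unfolding bil_def using E by (intro sum.neutral) auto
      thus ?thesis using True by (simp add: s_def)
    next
      case False
      hence s: "0 < s" using s0 by simp
      define z where "z v = (if v \<in> V then \<bar>y v\<bar> / sqrt s else 0)" for v
      have z2: "(z v)\<^sup>2 = (y v)\<^sup>2 / s" if "v \<in> V" for v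
        using that s by (simp add: z_def power_divide)
      hence "(\<Sum>v\<in>V. (z v)\<^sup>2) = (\<Sum>v\<in>V. (y v)\<^sup>2 / s)" by simp
      also have "\<dots> = s / s" unfolding s_def by (rule sum_divide_distrib[symmetric])
      finally have z1: "(\<Sum>v\<in>V. (z v)\<^sup>2) = 1" using s by simp
      have "z v \<le> 1" if "v \<in> V" for v
      proof -
        have "(z v)\<^sup>2 \<le> 1" using member_le_sum[of v V "\<lambda>v. (z v)\<^sup>2"] that fin z1 by simp
        thus ?thesis by (metis abs_le_square_iff abs_1 abs_le_D1 one_power2)
      qed
      hence "z \<in> K" using z1 s by (auto simp: K_def S_def z_def)
      have "bil E y y \<le> (\<Sum>p\<in>E. s * (z (fst p) * z (snd p)))"
        unfolding bil_def
      proof (rule sum_mono)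
        fix p assume "p \<in> E"
        hence "fst p \<in> V" "snd p \<in> V" using E by auto
        hence "s * (z (fst p) * z (snd p)) = \<bar>y (fst p)\<bar> * \<bar>y (snd p)\<bar>"
          using s by (simp add: z_def field_simps flip: power2_eq_square)
        also have "\<dots> = \<bar>y (fst p) * y (snd p)\<bar>" by (simp add: abs_mult)
        finally show "y (fst p) * y (snd p) \<le> s * (z (fst p) * z (snd p))" by simp
      qed
      also have "\<dots> = s * bil E z z" by (simp add: bil_def sum_distrib_left)
      also have "\<dots> \<le> s * bil E x x" using x(2)[OF \<open>z \<in> K\<close>] s by simp
      finally show ?thesis by (simp add: s_def mult.commute)
    qed
  qed
qed

text \<open>First-order condition. Moving \<open>x\<close> by \<open>s\<close> along the unit vector
  at \<open>u\<close> changes both sides of \<open>max\<close> quadratically, and the defect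
  \<open>c\<close> of the eigenvalue equation is the linear coefficient.
  \<open>2 * s * c \<le> l * s^2\<close> for every \<open>s\<close> forces
  \<open>c = 0\<close>.\<close>

lemma rayleigh_maximizer_eigenvector:
  assumes fin: "finite V" and E: "E \<subseteq> V \<times> V" "sym E" "irrefl E"
    and eq: "bil E x x = l * (\<Sum>v\<in>V. (x v)\<^sup>2)"
    and max: "\<And>y. bil E y y \<le> l * (\<Sum>v\<in>V. (y v)\<^sup>2)"
    and u: "u \<in> V"
  shows "(\<Sum>v\<in>E `` {u}. x v) = l * x u"
proof -
  define e :: "'a \<Rightarrow> real" where "e v = (if v = u then 1 else 0)" for v
  have e2: "(\<Sum>v\<in>V. e v * g v) = g u" for g :: "'a \<Rightarrow> real"
  proof -
    have "(\<Sum>v\<in>V. e v * g v) = (\<Sum>v\<in>V. if v = u then g v else 0)"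
      by (intro sum.cong) (auto simp: e_def)
    thus ?thesis using fin u by simp
  qed
  have ee: "bil E e e = 0"
    unfolding bil_def using E(3) by (intro sum.neutral) (auto simp: e_def irrefl_def)
  have ex: "bil E e x = (\<Sum>v\<in>E `` {u}. x v)"
    unfolding bil_rows[OF fin E(1)] e2 ..
  have xe: "bil E x e = (\<Sum>v\<in>E `` {u}. x v)" using bil_sym[OF E(2), of x e] ex by simp
  define c where "c = (\<Sum>v\<in>E `` {u}. x v) - l * x u"
  have l0: "0 \<le> l"
    using max[of e] ee e2[of e] by (simp add: power2_eq_square) (simp add: e_def)
  have *: "2 * s * c \<le> l * s\<^sup>2" for s
  proof -
    have "(\<Sum>v\<in>V. (x v + s * e v)\<^sup>2) = (\<Sum>v\<in>V. (x v)\<^sup>2 + (2 * s) * (e v * x v) + s\<^sup>2 * (e v * e v))"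
      by (intro sum.cong) (auto simp: power2_eq_square algebra_simps)
    also have "\<dots> = (\<Sum>v\<in>V. (x v)\<^sup>2) + 2 * s * x u + s\<^sup>2"
      using e2[of x] e2[of e] by (simp add: sum.distrib e_def flip: sum_distrib_left)
    finally have "bil E x x + 2 * s * (\<Sum>v\<in>E `` {u}. x v) \<le> l * ((\<Sum>v\<in>V. (x v)\<^sup>2) + 2 * s * x u + s\<^sup>2)"
      using max[of "\<lambda>v. x v + s * e v"] unfolding bil_add_scaled ee ex xe by simp
    thus ?thesis using eq by (simp add: c_def algebra_simps)
  qed
  \<comment> \<open>Dividing by \<open>l + 1\<close> rather than \<open>l\<close> also covers
    \<open>l = 0\<close>.\<close>
  define s where "s = c / (l + 1)"
  have c: "c = s * (l + 1)" using l0 by (simp add: s_def)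
  have "s\<^sup>2 * (2 * (l + 1)) \<le> s\<^sup>2 * l" using *[of s] unfolding c by (simp add: power2_eq_square algebra_simps)
  hence "s\<^sup>2 * (l + 2) \<le> 0" by (simp add: algebra_simps)
  hence "s = 0" using l0 by (simp add: mult_le_0_iff)
  thus ?thesis using c by (simp add: c_def)
qed

text \<open>Hong's bound. At a vertex with maximal entry, \<open>\<rho>\<^sup>2\<close> is at most the degree sum of the neighbours;
  the remaining vertices contribute at least one each to the total.\<close>
lemma eigenvalue_square_le:
  fixes x :: "'a \<Rightarrow> real"
  assumes fin: "finite V" and E: "E \<subseteq> V \<times> V" "sym E" "irrefl E"
    and deg1: "\<And>v. v \<in> V \<Longrightarrow> 1 \<le> deg E v"
    and x0: "\<And>v. v \<in> V \<Longrightarrow> 0 \<le> x v" and xn: "\<exists>v\<in>V. x v \<noteq> 0" and l0: "0 \<le> l"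
    and eig: "\<And>u. u \<in> V \<Longrightarrow> (\<Sum>v\<in>E `` {u}. x v) = l * x u"
  shows "l\<^sup>2 + real (card V) - 1 \<le> real (card E)"
proof -
  have fE: "finite (E `` {v})" for v using E fin by (meson finite_Image finite_SigmaI finite_subset)
  have "V \<noteq> {}" using xn by auto
  then obtain w where w: "w \<in> V" "\<And>v. v \<in> V \<Longrightarrow> x v \<le> x w"
    using obtains_MAX[OF fin, of x] fin by (metis Max_ge finite_imageI imageI)
  have xw: "0 < x w" using xn x0 w by (metis order_antisym_conv order_le_less)
  have EV: "E `` {v} \<subseteq> V" for v using E by auto
  have "l\<^sup>2 * x w = l * (\<Sum>v\<in>E `` {w}. x v)" using eig[OF w(1)] by (simp add: power2_eq_square)
  also have "\<dots> = (\<Sum>v\<in>E `` {w}. \<Sum>u\<in>E `` {v}. x u)"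
    unfolding sum_distrib_left using eig EV[of w] by (intro sum.cong) auto
  also have "\<dots> \<le> (\<Sum>v\<in>E `` {w}. \<Sum>u\<in>E `` {v}. x w)"
    using w(2) EV by (intro sum_mono) blast
  also have "\<dots> = (\<Sum>v\<in>E `` {w}. real (deg E v)) * x w" by (simp add: sum_distrib_right)
  finally have "l\<^sup>2 \<le> real (\<Sum>v\<in>E `` {w}. deg E v)" using xw by simp
  moreover have "(\<Sum>v\<in>E `` {w}. deg E v) + card V \<le> card E + 1"
  proof -
    have nw: "w \<notin> E `` {w}" using E(3) by (auto simp: irrefl_def)
    \<comment> \<open>The degree of \<open>w\<close> accounts for its neighbours and
      \<open>R\<close> for the vertices not adjacent to it; together they bring at least
      \<open>card V - 1\<close>.\<close>
    define R where "R = V - {w} - E `` {w}"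
    have V: "V = E `` {w} \<union> insert w R" using w EV by (auto simp: R_def)
    have "card E = (\<Sum>v\<in>V. deg E v)" using sum_deg[OF fin E(1)] ..
    also have "\<dots> = (\<Sum>v\<in>E `` {w}. deg E v) + (\<Sum>v\<in>insert w R. deg E v)"
      by (subst V, rule sum.union_disjoint) (use fE fin nw in \<open>auto simp: R_def\<close>)
    also have "(\<Sum>v\<in>insert w R. deg E v) = deg E w + (\<Sum>v\<in>R. deg E v)"
      using fin by (subst sum.insert) (auto simp: R_def)
    finally have 1: "card E = (\<Sum>v\<in>E `` {w}. deg E v) + deg E w + (\<Sum>v\<in>R. deg E v)" by simp
    have "card R \<le> (\<Sum>v\<in>R. deg E v)"
      using sum_mono[of R "\<lambda>_. 1" "deg E"] deg1 by (simp add: R_def)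
    moreover have "card V = deg E w + Suc (card R)"
      by (subst V, subst card_Un_disjoint) (use fE fin nw in \<open>auto simp: R_def\<close>)
    ultimately show ?thesis using 1 by linarith
  qed
  ultimately show ?thesis by linarith
qed

text \<open>At a zero entry the eigenvalue equation is a vanishing sum of nonnegative terms, so all
  neighbours have entry zero too. Connectivity takes the form of a cut condition, to be applied to
  the zero set.\<close>

lemma eigenvector_pos:
  fixes x :: "'a \<Rightarrow> real"
  assumes fin: "finite V" and E: "E \<subseteq> V \<times> V"
    and conn: "\<And>S. S \<subseteq> V \<Longrightarrow> S \<noteq> {} \<Longrightarrow> S \<noteq> V \<Longrightarrow> \<exists>u\<in>S. \<exists>v\<in>V - S. (u, v) \<in> E"
    and x0: "\<And>v. v \<in> V \<Longrightarrow> 0 \<le> x v" and xn: "\<exists>v\<in>V. x v \<noteq> 0"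
    and eig: "\<And>u. u \<in> V \<Longrightarrow> (\<Sum>v\<in>E `` {u}. x v) = l * x u"
    and v: "v \<in> V"
  shows "0 < x v"
proof (rule ccontr)
  assume "\<not> ?thesis"
  hence "x v = 0" using x0[OF v] by simp
  then obtain u w where u: "u \<in> V" "x u = 0" and w: "w \<in> V" "x w \<noteq> 0" "(u, w) \<in> E"
    using conn[of "{v \<in> V. x v = 0}"] v xn by auto
  have "finite (E `` {u})" using E fin by (meson finite_Image finite_SigmaI finite_subset)
  moreover have "0 \<le> x z" if "z \<in> E `` {u}" for z using that E x0 by auto
  moreover have "(\<Sum>v\<in>E `` {u}. x v) = 0" using eig[OF u(1)] u by simp
  ultimately have "\<forall>z\<in>E `` {u}. x z = 0" by (subst (asm) sum_nonneg_eq_0_iff) auto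
  thus False using w by auto
qed

section \<open>The exceptional case\<close>

text \<open>A copy of the extremal graph on \<open>V\<close>: \<open>z\<close> is the added vertex, \<open>T - {z}\<close> its neighbourhood, \<open>P\<close> the
  clique of order \<open>a - 1\<close> joined to everything except \<open>z\<close>.\<close>
definition ext_arcs :: "'a set \<Rightarrow> 'a set \<Rightarrow> 'a \<Rightarrow> 'a set \<Rightarrow> ('a \<times> 'a) set" where
  "ext_arcs V T z P = ((V - T) \<times> (V - T) - Id) \<union> {z} \<times> (T - {z}) \<union> (T - {z}) \<times> {z} \<union>
     (T - {z}) \<times> P \<union> P \<times> (T - {z})"

text \<open>The common part cancels; the rest of \<open>A\<close> injects into the rest of
  \<open>P\<close>, and each image dominates its source.\<close>

lemma sum_le_sum_top:
  fixes x :: "'a \<Rightarrow> real"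
  assumes "finite P" "finite A" "card A \<le> card P"
    and top: "\<And>p q. p \<in> P \<Longrightarrow> q \<in> A - P \<Longrightarrow> x q \<le> x p" and nonneg: "\<And>p. p \<in> P \<Longrightarrow> 0 \<le> x p"
  shows "(\<Sum>v\<in>A. x v) \<le> (\<Sum>v\<in>P. x v)"
proof -
  have "card (A - P) \<le> card (P - A)"
    using assms(1-3) card_Int_Diff[of A P] card_Int_Diff[of P A] by (simp add: Int_commute)
  then obtain Q where Q: "Q \<subseteq> P - A" "card Q = card (A - P)" by (rule obtain_subset_with_card_n)
  have finQ: "finite Q" using Q(1) assms(1) by (meson finite_Diff finite_subset)
  obtain h where h: "bij_betw h (A - P) Q"
    using finite_same_card_bij[of "A - P" Q] assms(2) finQ Q(2) by auto
  have "(\<Sum>v\<in>A - P. x v) \<le> (\<Sum>v\<in>A - P. x (h v))"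
    using h Q(1) by (intro sum_mono top) (auto dest: bij_betwE)
  also have "\<dots> = (\<Sum>v\<in>Q. x v)" by (rule sum.reindex_bij_betw[OF h])
  also have "\<dots> \<le> (\<Sum>v\<in>P - A. x v)" using Q(1) assms(1) nonneg by (intro sum_mono2) auto
  finally have "(\<Sum>v\<in>A - P. x v) \<le> (\<Sum>v\<in>P - A. x v)" .
  moreover have "(\<Sum>v\<in>A. x v) = (\<Sum>v\<in>A \<inter> P. x v) + (\<Sum>v\<in>A - P. x v)"
    using assms(2) by (rule sum.Int_Diff)
  moreover have "(\<Sum>v\<in>P. x v) = (\<Sum>v\<in>P \<inter> A. x v) + (\<Sum>v\<in>P - A. x v)"
    using assms(1) by (rule sum.Int_Diff)
  ultimately show ?thesis by (simp add: Int_commute)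
qed

lemma ex_top_subset:
  fixes x :: "'a \<Rightarrow> real"
  assumes "finite A" "k \<le> card A"
  shows "\<exists>P \<subseteq> A. card P = k \<and> (\<forall>p\<in>P. \<forall>q\<in>A - P. x q \<le> x p)"
  using assms(2)
proof (induction k)
  case (Suc k)
  have "k \<le> card A" using Suc.prems by simp
  then obtain P where P: "P \<subseteq> A" "card P = k" "\<forall>p\<in>P. \<forall>q\<in>A - P. x q \<le> x p"
    using Suc.IH by blast
  have finP: "finite P" using P(1) assms(1) finite_subset by blast
  have ne: "A - P \<noteq> {}" using P Suc.prems finP by (metis Diff_eq_empty_iff card_mono not_less_eq_eq)
  have finD: "finite (A - P)" using assms(1) by simp
  obtain m where m: "m \<in> A - P" "Max (x ` (A - P)) = x m"
    by (rule obtains_MAX[OF finD ne, of x])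
  have "x q \<le> x m" if "q \<in> A - P" for q unfolding m(2)[symmetric] using that assms(1) by simp
  hence "\<forall>p\<in>insert m P. \<forall>q\<in>A - insert m P. x q \<le> x p" using P(3) by auto
  moreover have "card (insert m P) = Suc k" using m(1) finP P(2) by simp
  ultimately show ?case using P(1) m(1) by (intro exI[of _ "insert m P"]) auto
next
  case 0
  show ?case by (intro exI[of _ "{}"]) auto
qed

section \<open>Splitting the quadratic form around the vertex \<open>z\<close>\<close>

lemma bil_block:
  assumes "finite A" "finite E"
  shows "bil (E \<inter> A \<times> B) x y = (\<Sum>u\<in>A. x u * (\<Sum>v\<in>E `` {u} \<inter> B. y v))"
proof -
  have "E \<inter> A \<times> B = (SIGMA u:A. E `` {u} \<inter> B)" by auto
  hence "bil (E \<inter> A \<times> B) x y = (\<Sum>p\<in>(SIGMA u:A. E `` {u} \<inter> B). x (fst p) * y (snd p))"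
    by (simp add: bil_def)
  also have "\<dots> = (\<Sum>u\<in>A. \<Sum>v\<in>E `` {u} \<inter> B. x u * y v)"
    using assms by (subst sum.Sigma) (auto simp: case_prod_unfold finite_Image)
  finally show ?thesis by (simp add: sum_distrib_left)
qed

text \<open>Arcs between \<open>R\<close> and \<open>W\<close> are charged to their end in
  \<open>W\<close>, hence the factor 2; arcs inside \<open>W\<close> are already seen from both
  ends, hence the division by 2 under that factor. Graphs with the same \<open>z\<close> and
  \<open>W\<close> can then be compared vertex by vertex.\<close>

lemma bil_hub:
  assumes fin: "finite R" "finite W" and disj: "z \<notin> R" "z \<notin> W" "R \<inter> W = {}"
    and E: "E \<subseteq> insert z (R \<union> W) \<times> insert z (R \<union> W)" "sym E" "E `` {z} = W"
  shows "bil E x x = (\<Sum>u\<in>R. x u * (\<Sum>v\<in>E `` {u} \<inter> R. x v)) + 2 * (x z * (\<Sum>w\<in>W. x w)) +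
    2 * (\<Sum>w\<in>W. x w * ((\<Sum>v\<in>E `` {w} \<inter> R. x v) + (\<Sum>v\<in>E `` {w} \<inter> W. x v) / 2))"
proof -
  have finE: "finite E" using E(1) fin by (meson finite_SigmaI finite_UnI finite_insert finite_subset)
  have fE: "finite (E `` {v})" for v using finE by (simp add: finite_Image)
  have Ez: "(v, z) \<in> E \<longleftrightarrow> v \<in> W" for v using E(2,3) by (auto dest: symD)
  have row_R: "(\<Sum>v\<in>E `` {u}. x v) = (\<Sum>v\<in>E `` {u} \<inter> R. x v) + (\<Sum>v\<in>E `` {u} \<inter> W. x v)" if "u \<in> R" for u
  proof -
    have "E `` {u} = (E `` {u} \<inter> R) \<union> (E `` {u} \<inter> W)" using E(1) Ez disj that by auto
    thus ?thesis using fE disj by (metis (no_types, lifting) Int_assoc Int_commute Int_empty_right finite_Int sum.union_disjoint)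
  qed
  have row_W: "(\<Sum>v\<in>E `` {u}. x v) = x z + ((\<Sum>v\<in>E `` {u} \<inter> R. x v) + (\<Sum>v\<in>E `` {u} \<inter> W. x v))" if "u \<in> W" for u
  proof -
    have "E `` {u} = insert z ((E `` {u} \<inter> R) \<union> (E `` {u} \<inter> W))" using E(1) Ez that by auto
    hence "(\<Sum>v\<in>E `` {u}. x v) = (\<Sum>v\<in>insert z ((E `` {u} \<inter> R) \<union> (E `` {u} \<inter> W)). x v)" by simp
    also have "\<dots> = x z + (\<Sum>v\<in>(E `` {u} \<inter> R) \<union> (E `` {u} \<inter> W). x v)"
      using fE disj by (intro sum.insert) auto
    also have "(\<Sum>v\<in>(E `` {u} \<inter> R) \<union> (E `` {u} \<inter> W). x v) =
        (\<Sum>v\<in>E `` {u} \<inter> R. x v) + (\<Sum>v\<in>E `` {u} \<inter> W. x v)"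
      using fE disj by (intro sum.union_disjoint) auto
    finally show ?thesis .
  qed
  have swap: "(\<Sum>u\<in>R. x u * (\<Sum>v\<in>E `` {u} \<inter> W. x v)) = (\<Sum>u\<in>W. x u * (\<Sum>v\<in>E `` {u} \<inter> R. x v))"
  proof -
    have bij: "bij_betw prod.swap (E \<inter> W \<times> R) (E \<inter> R \<times> W)"
      using E(2) by (intro bij_betw_byWitness[where f' = prod.swap]) (auto simp: sym_def)
    have "bil (E \<inter> R \<times> W) x x = bil (E \<inter> W \<times> R) x x"
      using sum.reindex_bij_betw[OF bij, of "\<lambda>p. x (fst p) * x (snd p)"]
      by (simp add: bil_def mult.commute)
    thus ?thesis using bil_block[OF _ finE] fin by simp
  qed
  have "bil E x x = (\<Sum>u\<in>insert z (R \<union> W). x u * (\<Sum>v\<in>E `` {u}. x v))"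
    using fin E(1) by (intro bil_rows) auto
  also have "\<dots> = x z * (\<Sum>v\<in>W. x v) + ((\<Sum>u\<in>R. x u * (\<Sum>v\<in>E `` {u}. x v)) +
      (\<Sum>u\<in>W. x u * (\<Sum>v\<in>E `` {u}. x v)))"
    using fin disj E(3) by (simp add: sum.union_disjoint)
  also have "(\<Sum>u\<in>R. x u * (\<Sum>v\<in>E `` {u}. x v)) = (\<Sum>u\<in>R. x u * (\<Sum>v\<in>E `` {u} \<inter> R. x v)) +
      (\<Sum>u\<in>W. x u * (\<Sum>v\<in>E `` {u} \<inter> R. x v))"
    using row_R by (simp add: distrib_left sum.distrib swap)
  also have "(\<Sum>u\<in>W. x u * (\<Sum>v\<in>E `` {u}. x v)) = x z * (\<Sum>w\<in>W. x w) +
      ((\<Sum>u\<in>W. x u * (\<Sum>v\<in>E `` {u} \<inter> R. x v)) + (\<Sum>u\<in>W. x u * (\<Sum>v\<in>E `` {u} \<inter> W. x v)))"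
    using row_W by (simp add: distrib_left sum.distrib sum_distrib_left mult.commute)
  finally show ?thesis by (simp add: distrib_left sum.distrib sum_divide_distrib[symmetric])
qed

text \<open>Let \<open>X\<close> be the largest entry and suppose \<open>x p \<le> x t\<close>.
  Entries on \<open>T\<close> are at most \<open>(a + 1) * X / l\<close> by the eigenvalue equation,
  hence so is \<open>x p\<close>, and with it every entry outside \<open>T\<close> and
  \<open>P\<close>. Only the \<open>a - 2\<close> vertices of \<open>P - {p}\<close> can be large,
  and the equation at the largest entry gives \<open>l * (l - a + 2) \<le> n * (a + 1)\<close>,
  absurd for \<open>l\<close> close to \<open>n\<close>.\<close>

lemma low_degree_entries_small:
  fixes x :: "'a \<Rightarrow> real"
  assumes fin: "finite V" and E: "E \<subseteq> V \<times> V" and a: "2 \<le> a"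
    and n: "card V = n" "2 * a\<^sup>2 + 136 * a + 264 \<le> n"
    and TV: "T \<subseteq> V" and degT: "\<And>t. t \<in> T \<Longrightarrow> deg E t \<le> a + 1"
    and pos: "\<And>v. v \<in> V \<Longrightarrow> 0 < x v"
    and eig: "\<And>u. u \<in> V \<Longrightarrow> (\<Sum>v\<in>E `` {u}. x v) = l * x u"
    and l: "real n - real a - 3 \<le> l"
    and P: "P \<subseteq> V - T" "card P = a - 1" "\<And>p q. p \<in> P \<Longrightarrow> q \<in> V - T - P \<Longrightarrow> x q \<le> x p"
    and p: "p \<in> P" and t: "t \<in> T"
  shows "x t < x p"
proof (rule ccontr)
  assume "\<not> x t < x p"
  hence pt: "x p \<le> x t" by simp
  have fE: "finite (E `` {v})" for v using E fin by (meson finite_Image finite_SigmaI finite_subset)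
  have EV: "E `` {v} \<subseteq> V" for v using E by auto
  have tV: "t \<in> V" using t TV by auto
  have finP: "finite P" using P(1) fin by (meson finite_Diff finite_subset)
  have "V \<noteq> {}" using tV by auto
  then obtain w where w: "w \<in> V" "\<And>v. v \<in> V \<Longrightarrow> x v \<le> x w"
    using obtains_MAX[OF fin, of x] fin by (metis Max_ge finite_imageI imageI)
  define X where "X = x w"
  have X0: "0 < X" using pos w by (simp add: X_def)
  have nn: "real n \<ge> 2 * (real a * real a) + 136 * real a + 264"
    using of_nat_mono[OF n(2), where 'a = real] by (simp add: power2_eq_square)
  have a2: "2 \<le> real a" using a by simp
  have aa: "0 \<le> real a * real a" by simp
  have l0: "0 < l" using l nn a2 aa by linarith
  define s where "s = (real a + 1) * X / l"
  have s0: "0 \<le> s" using X0 l0 by (simp add: s_def)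
  have small_T: "x u \<le> s" if "u \<in> T" for u
  proof -
    have "l * x u = (\<Sum>v\<in>E `` {u}. x v)" using eig that TV by auto
    also have "\<dots> \<le> (\<Sum>v\<in>E `` {u}. X)" using w EV by (intro sum_mono) (auto simp: X_def)
    also have "\<dots> = real (deg E u) * X" by simp
    also have "\<dots> \<le> (real a + 1) * X" using degT[OF that] X0 by (intro mult_right_mono) auto
    finally show ?thesis using l0 by (simp add: s_def field_simps)
  qed
  have small: "x u \<le> s" if u: "u \<in> V - (P - {p})" for u
  proof -
    consider "u \<in> T" | "u = p" | "u \<in> V - T - P" using u by blast
    thus ?thesis
    proof cases
      case 3
      thus ?thesis using P(3)[OF p] pt small_T[OF t] by force
    qed (use small_T[OF t] small_T pt in auto)
  qed
  have "l * X = (\<Sum>v\<in>E `` {w}. x v)" using eig w by (simp add: X_def)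
  also have "\<dots> \<le> (\<Sum>v\<in>V. x v)" using EV fin pos by (intro sum_mono2) (auto intro: less_imp_le)
  also have "\<dots> = (\<Sum>v\<in>P - {p}. x v) + (\<Sum>v\<in>V - (P - {p}). x v)"
    using P(1) fin by (subst sum.subset_diff[of "P - {p}" V]) auto
  also have "\<dots> \<le> (\<Sum>v\<in>P - {p}. X) + (\<Sum>v\<in>V - (P - {p}). s)"
    using small w P(1) by (intro add_mono sum_mono) (auto simp: X_def)
  also have "\<dots> \<le> (real a - 2) * X + real n * s"
  proof (intro add_mono)
    show "(\<Sum>v\<in>P - {p}. X) \<le> (real a - 2) * X" using P(2) p finP a by (simp add: of_nat_diff)
    have "card (V - (P - {p})) \<le> n" using n(1) fin by (metis Diff_subset card_mono)
    thus "(\<Sum>v\<in>V - (P - {p}). s) \<le> real n * s" using s0 by (simp add: mult_right_mono)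
  qed
  finally have "l * X \<le> (real a - 2) * X + real n * s" .
  hence "l * (l * X) \<le> l * ((real a - 2) * X + real n * s)" using l0 by simp
  also have "\<dots> = (l * (real a - 2) + real n * (real a + 1)) * X"
    using l0 by (simp add: s_def field_simps)
  finally have "(l * l) * X \<le> (l * (real a - 2) + real n * (real a + 1)) * X" by (simp add: mult.assoc)
  hence "l * l \<le> l * (real a - 2) + real n * (real a + 1)" using X0 by simp
  hence 1: "l * (l - real a + 2) \<le> real n * (real a + 1)" by (simp add: algebra_simps)
  have "(real n - real a - 3) * (real n - 2 * real a - 1) \<le> l * (l - real a + 2)"
    by (intro mult_mono) (use l nn a2 aa in linarith)+
  hence "(real n - real a - 3) * (real n - 2 * real a - 1) \<le> real n * (real a + 1)" using 1 by linarith
  hence "real n * (real n - 4 * real a - 5) + (real a + 3) * (2 * real a + 1) \<le> 0"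
    by (simp add: algebra_simps)
  moreover have "0 < real n * (real n - 4 * real a - 5)"
    using nn a2 aa by (intro mult_pos_pos) linarith+
  moreover have "0 < (real a + 3) * (2 * real a + 1)" using a2 by (intro mult_pos_pos) auto
  ultimately show False by linarith
qed

text \<open>\<open>bil_hub\<close> compares \<open>E\<close> with the rearranged \<open>E'\<close>
  term by term: \<open>R\<close> becomes complete, and each vertex of \<open>W\<close> trades its
  neighbours other than \<open>z\<close> for \<open>P\<close>. By \<open>ext\<close> the result
  cannot exceed \<open>l\<close>, so every comparison is an equality, and positivity of
  \<open>x\<close> turns equal sums over nested sets into equal sets.\<close>

lemma bad_case_eq_ext_arcs:
  fixes x :: "'a \<Rightarrow> real"
  assumes fin: "finite V" and E: "E \<subseteq> V \<times> V" "sym E" "irrefl E" and a: "2 \<le> a"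
    and n: "card V = n" "2 * a\<^sup>2 + 136 * a + 264 \<le> n"
    and TV: "T \<subseteq> V" "card T = a + 2"
    and z: "z \<in> T" "E `` {z} = T - {z}"
    and degT: "\<And>t. t \<in> T \<Longrightarrow> E `` {t} \<noteq> T - {t} \<Longrightarrow> deg E t = a"
    and pos: "\<And>v. v \<in> V \<Longrightarrow> 0 < x v"
    and ray: "bil E x x = l * (\<Sum>v\<in>V. (x v)\<^sup>2)" "\<And>y. bil E y y \<le> l * (\<Sum>v\<in>V. (y v)\<^sup>2)"
    and l: "real n - real a - 3 \<le> l"
    and ext: "\<And>P y. P \<subseteq> V - T \<Longrightarrow> card P = a - 1 \<Longrightarrow>
      bil (ext_arcs V T z P) y y \<le> l * (\<Sum>v\<in>V. (y v)\<^sup>2)"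
  shows "\<exists>P. P \<subseteq> V - T \<and> card P = a - 1 \<and> E = ext_arcs V T z P"
proof -
  have finT: "finite T" using TV fin finite_subset by blast
  have finE: "finite E" using E fin by (meson finite_SigmaI finite_subset)
  have fE: "finite (E `` {v})" for v using finE by (simp add: finite_Image)
  have EV: "E `` {v} \<subseteq> V" for v using E by auto
  have eig: "(\<Sum>v\<in>E `` {u}. x v) = l * x u" if "u \<in> V" for u
    by (rule rayleigh_maximizer_eigenvector[OF fin E ray that])
  define R where "R = V - T"
  define W where "W = T - {z}"
  have finR: "finite R" and finW: "finite W" using fin finT by (auto simp: R_def W_def)
  have "a + 2 + card R = n" using TV n(1) fin finT card_mono[OF fin TV(1)]
    by (simp add: R_def card_Diff_subset)
  hence "a - 1 \<le> card R" using n(2) a by simp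
  then obtain P where P: "P \<subseteq> R" "card P = a - 1" "\<forall>p\<in>P. \<forall>q\<in>R - P. x q \<le> x p"
    using ex_top_subset[OF finR, of "a - 1" x] by blast
  have finP: "finite P" using P(1) finR finite_subset by blast
  have VRW: "V = insert z (R \<union> W)" using TV z by (auto simp: R_def W_def)
  have degT': "deg E t \<le> a + 1" if "t \<in> T" for t
    using degT[OF that] TV(2) that finT by (cases "E `` {t} = T - {t}") auto
  have PT: "x t < x p" if "p \<in> P" "t \<in> T" for p t
    using low_degree_entries_small[OF fin E(1) a n TV(1) degT' pos eig l, of P p t] P that
    by (auto simp: R_def)
  have nonneg: "0 \<le> x v" if "v \<in> V" for v using pos[OF that] by simp
  have RV: "R \<subseteq> V" "W \<subseteq> V" "P \<subseteq> V" "z \<in> V" using P(1) TV z by (auto simp: R_def W_def)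
  define E' where "E' = ext_arcs V T z P"
  have E': "E' = (R \<times> R - Id) \<union> {z} \<times> W \<union> W \<times> {z} \<union> W \<times> P \<union> P \<times> W"
    by (simp add: E'_def ext_arcs_def R_def W_def)
  have E'V: "E' \<subseteq> V \<times> V" using RV by (auto simp: E')
  have symE': "sym E'" by (auto simp: E' sym_def)
  have irrE': "irrefl E'" using P(1) by (auto simp: E' irrefl_def R_def W_def)
  define sP where "sP = (\<Sum>v\<in>P. x v)"
  have zN: "E `` {z} = W" using z by (simp add: W_def)
  have Wz: "z \<in> E `` {w}" if "w \<in> W" for w using that zN E(2) by (auto dest: symD)

  text \<open>A vertex of \<open>W\<close> pays for each neighbour in \<open>R\<close> fully and for each neighbour in \<open>W\<close> by half,
    the other half being paid by that neighbour.\<close>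
  define g where "g w = (\<Sum>v\<in>E `` {w} \<inter> R. x v) + (\<Sum>v\<in>E `` {w} \<inter> W. x v) / 2" for w
  have nbr: "E `` {w} - {z} = (E `` {w} \<inter> R) \<union> (E `` {w} \<inter> W)" for w
    using EV[of w] RV(4) z(1) by (auto simp: R_def W_def)
  have nbr_sum: "(\<Sum>v\<in>E `` {w} - {z}. x v) = (\<Sum>v\<in>E `` {w} \<inter> R. x v) + (\<Sum>v\<in>E `` {w} \<inter> W. x v)" for w
    unfolding nbr using fE by (intro sum.union_disjoint) (auto simp: R_def W_def)
  have top: "x q \<le> x p" if "p \<in> P" "q \<in> V - P" "q \<noteq> z" for p q
    using that P(3) PT[of p q] by (cases "q \<in> T") (auto simp: R_def)
  have g: "g w \<le> sP \<and> (g w = sP \<longrightarrow> E `` {w} \<inter> W = {})" if w: "w \<in> W" for w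
  proof (cases "E `` {w} = T - {w}")
    case False
    hence "deg E w = a" using degT[of w] w by (auto simp: W_def)
    \<comment> \<open>Besides \<open>z\<close> there are \<open>a - 1\<close> neighbours, as many as
      \<open>P\<close> has vertices. Those in \<open>W\<close> enter \<open>g\<close> at half weight
      only, so a single one makes the inequality strict.\<close>
    hence "card (E `` {w} - {z}) = a - 1" using Wz[OF w] fE by simp
    hence "(\<Sum>v\<in>E `` {w} - {z}. x v) \<le> sP"
      unfolding sP_def using P(2) finP fE EV RV nonneg by (intro sum_le_sum_top top) auto
    hence le: "g w + (\<Sum>v\<in>E `` {w} \<inter> W. x v) / 2 \<le> sP" unfolding nbr_sum g_def by simp
    have "0 \<le> (\<Sum>v\<in>E `` {w} \<inter> W. x v)" using RV nonneg by (intro sum_nonneg) auto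
    moreover have "0 < (\<Sum>v\<in>E `` {w} \<inter> W. x v)" if "E `` {w} \<inter> W \<noteq> {}"
      using RV pos that fE by (intro sum_pos) auto
    ultimately show ?thesis using le by (cases "E `` {w} \<inter> W = {}") simp_all
  next
    case True
    have "E `` {w} \<inter> R = {}" using True by (auto simp: R_def)
    moreover have eqW: "E `` {w} \<inter> W = W - {w}" unfolding True by (auto simp: W_def)
    ultimately have gw: "g w = (\<Sum>v\<in>W - {w}. x v) / 2" by (simp add: g_def eqW)
    \<comment> \<open>Now \<open>w\<close> has \<open>a\<close> neighbours besides \<open>z\<close>,
      one more than \<open>card P\<close>, but all lie in \<open>W\<close> and count half. One entry
      is below an entry of \<open>P\<close> and the other \<open>a - 1\<close> sum to at most
      \<open>sP\<close>, so half the total stays strictly below \<open>sP\<close>.\<close>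
    have "card W = a + 1" using TV(2) z(1) finT by (simp add: W_def)
    hence cW: "card (W - {w}) = a" using w finW by simp
    have "W - {w} \<noteq> {}" using cW a by (metis card.empty not_numeral_le_zero)
    then obtain t where t: "t \<in> W - {w}" by blast
    have "P \<noteq> {}" using P(2) a by auto
    then obtain p where p: "p \<in> P" by blast
    have "(\<Sum>v\<in>W - {w}. x v) = x t + (\<Sum>v\<in>W - {w} - {t}. x v)"
      using t finW by (intro sum.remove) auto
    also have "x t < x p" using PT[OF p] t by (auto simp: W_def)
    also have "x p \<le> sP" unfolding sP_def using p finP RV nonneg by (intro member_le_sum) auto
    also have "(\<Sum>v\<in>W - {w} - {t}. x v) \<le> sP"
      unfolding sP_def
    proof (intro sum_le_sum_top top)
      show "card (W - {w} - {t}) \<le> card P" using cW t finW P(2) by simp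
    qed (use finP finW RV nonneg in \<open>auto simp: W_def\<close>)
    finally have "g w < sP" unfolding gw by simp
    thus ?thesis by simp
  qed

  have hub: "bil F x x = (\<Sum>u\<in>R. x u * (\<Sum>v\<in>F `` {u} \<inter> R. x v)) + 2 * (x z * (\<Sum>w\<in>W. x w)) +
      2 * (\<Sum>w\<in>W. x w * ((\<Sum>v\<in>F `` {w} \<inter> R. x v) + (\<Sum>v\<in>F `` {w} \<inter> W. x v) / 2))"
    if "F \<subseteq> V \<times> V" "sym F" "F `` {z} = W" for F
  proof (rule bil_hub[OF finR finW _ _ _ _ that(2,3)])
    show "F \<subseteq> insert z (R \<union> W) \<times> insert z (R \<union> W)" using that(1) by (simp flip: VRW)
  qed (use z(1) in \<open>auto simp: R_def W_def\<close>)
  have E'z: "E' `` {z} = W" using z P(1) by (auto simp: E' R_def W_def)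
  have E'R: "E' `` {u} \<inter> R = R - {u}" if "u \<in> R" for u
    using that z(1) P(1) by (auto simp: E' R_def W_def)
  have E'W: "E' `` {w} \<inter> R = P" "E' `` {w} \<inter> W = {}" if "w \<in> W" for w
    using that z(1) P(1) by (auto simp: E' R_def W_def)
  have bE: "bil E x x = (\<Sum>u\<in>R. x u * (\<Sum>v\<in>E `` {u} \<inter> R. x v)) + 2 * (x z * (\<Sum>w\<in>W. x w)) +
      2 * (\<Sum>w\<in>W. x w * g w)"
    unfolding g_def by (rule hub[OF E(1,2) zN])
  have bE': "bil E' x x = (\<Sum>u\<in>R. x u * (\<Sum>v\<in>R - {u}. x v)) + 2 * (x z * (\<Sum>w\<in>W. x w)) +
      2 * (\<Sum>w\<in>W. x w * sP)"
    unfolding hub[OF E'V symE' E'z] using E'R E'W by (simp add: sP_def)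
  have ext': "bil E' y y \<le> l * (\<Sum>v\<in>V. (y v)\<^sup>2)" for y
    unfolding E'_def using P by (intro ext) (auto simp: R_def)
  have ER: "E `` {u} \<inter> R \<subseteq> R - {u}" for u using E(3) by (auto simp: irrefl_def)
  have rowR: "x u * (\<Sum>v\<in>E `` {u} \<inter> R. x v) \<le> x u * (\<Sum>v\<in>R - {u}. x v)" if "u \<in> R" for u
    using that RV nonneg finR ER by (intro mult_left_mono sum_mono2) auto
  have rowW: "x w * g w \<le> x w * sP" if "w \<in> W" for w
    using that RV nonneg g[OF that] by (intro mult_left_mono) auto
  have leR: "(\<Sum>u\<in>R. x u * (\<Sum>v\<in>E `` {u} \<inter> R. x v)) \<le> (\<Sum>u\<in>R. x u * (\<Sum>v\<in>R - {u}. x v))"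
    by (rule sum_mono[OF rowR])
  have leW: "(\<Sum>w\<in>W. x w * g w) \<le> (\<Sum>w\<in>W. x w * sP)"
    by (rule sum_mono[OF rowW])
  have le: "bil E' x x \<le> bil E x x" using ext'[of x] ray(1) by simp
  have eqR: "(\<Sum>u\<in>R. x u * (\<Sum>v\<in>E `` {u} \<inter> R. x v)) = (\<Sum>u\<in>R. x u * (\<Sum>v\<in>R - {u}. x v))"
    and eqW: "(\<Sum>w\<in>W. x w * g w) = (\<Sum>w\<in>W. x w * sP)"
    using le leR leW unfolding bE bE' by linarith+
  \<comment> \<open>So \<open>x\<close> attains the maximum \<open>l\<close> for \<open>E'\<close>
    as well and satisfies the eigenvalue equations of \<open>E'\<close>.\<close>
  have "bil E' x x = bil E x x" unfolding bE bE' eqR eqW ..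
  hence eig': "(\<Sum>v\<in>E' `` {u}. x v) = l * x u" if "u \<in> V" for u
    using rayleigh_maximizer_eigenvector[OF fin E'V symE' irrE' _ ext' that, of x] ray(1) by simp
  have sub_eq: "A = B" if "A \<subseteq> B" "finite B" "B \<subseteq> V" "(\<Sum>v\<in>A. x v) = (\<Sum>v\<in>B. x v)" for A B
  proof (rule ccontr)
    assume "A \<noteq> B"
    hence "0 < (\<Sum>v\<in>B - A. x v)" using that pos by (intro sum_pos) auto
    thus False using sum.subset_diff[OF that(1,2), of x] that(4) by simp
  qed
  have FR: "E `` {u} \<inter> R = R - {u}" if u: "u \<in> R" for u
  proof (rule sub_eq[OF ER])
    have "x u * (\<Sum>v\<in>E `` {u} \<inter> R. x v) = x u * (\<Sum>v\<in>R - {u}. x v)"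
      using sum_mono_inv[OF eqR rowR u finR] by simp
    thus "(\<Sum>v\<in>E `` {u} \<inter> R. x v) = (\<Sum>v\<in>R - {u}. x v)" using pos[of u] u RV by auto
  qed (use finR RV in auto)
  have FW: "E `` {w} \<inter> W = {}" if w: "w \<in> W" for w
  proof -
    have "x w * g w = x w * sP" using sum_mono_inv[OF eqW rowW w finW] by simp
    hence "g w = sP" using pos[of w] w RV by auto
    thus ?thesis using g[OF w] by simp
  qed
  \<comment> \<open>With tied entries, \<open>g w = sP\<close> does not determine the neighbours of
    \<open>w\<close> in \<open>R\<close>. At \<open>u\<close>, the equations for \<open>E\<close>
    and \<open>E'\<close> have the same right-hand side and, by \<open>FR\<close>, the same part in
    \<open>R\<close>; hence the parts in \<open>W\<close> have equal sums, and the one for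
    \<open>E'\<close> is all of \<open>W\<close> or empty.\<close>
  have FP: "E `` {u} \<inter> W = (if u \<in> P then W else {})" if u: "u \<in> R" for u
  proof -
    have row: "(\<Sum>v\<in>F `` {u}. x v) = (\<Sum>v\<in>F `` {u} \<inter> R. x v) + (\<Sum>v\<in>F `` {u} \<inter> W. x v)"
      if F: "F \<subseteq> V \<times> V" "sym F" "F `` {z} = W" for F
    proof -
      have "F `` {u} = (F `` {u} \<inter> R) \<union> (F `` {u} \<inter> W)"
      proof -
        have "u \<notin> W" using u by (auto simp: R_def W_def)
        hence "z \<notin> F `` {u}" using F(2,3) by (auto dest: symD)
        moreover have "F `` {u} \<subseteq> insert z (R \<union> W)" using F(1) VRW by blast
        ultimately show ?thesis by blast
      qed
      moreover have "(\<Sum>v\<in>(F `` {u} \<inter> R) \<union> (F `` {u} \<inter> W). x v) =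
          (\<Sum>v\<in>F `` {u} \<inter> R. x v) + (\<Sum>v\<in>F `` {u} \<inter> W. x v)"
        using finR finW by (intro sum.union_disjoint) (auto simp: R_def W_def)
      ultimately show ?thesis by simp
    qed
    have "u \<in> V" using u RV by auto
    hence "(\<Sum>v\<in>E `` {u}. x v) = (\<Sum>v\<in>E' `` {u}. x v)" using eig eig' by simp
    hence "(\<Sum>v\<in>E `` {u} \<inter> W. x v) = (\<Sum>v\<in>E' `` {u} \<inter> W. x v)"
      unfolding row[OF E(1,2) zN] row[OF E'V symE' E'z] FR[OF u] E'R[OF u] by simp
    moreover have "E' `` {u} \<inter> W = (if u \<in> P then W else {})"
      using u z(1) by (auto simp: E' R_def W_def)
    ultimately have eq: "(\<Sum>v\<in>E `` {u} \<inter> W. x v) = (\<Sum>v\<in>(if u \<in> P then W else {}). x v)" by simp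
    show ?thesis
    proof (cases "u \<in> P")
      case True
      thus ?thesis using eq finW RV by (simp, intro sub_eq) auto
    next
      case False
      have "{} = E `` {u} \<inter> W"
        by (rule sub_eq) (use False eq finW RV in auto)
      thus ?thesis using False by simp
    qed
  qed
  have cases: "(u, v) \<in> E \<longleftrightarrow> (u, v) \<in> E'" if "u \<in> V" "v \<in> V" for u v
  proof -
    have RR: "(u, v) \<in> E \<longleftrightarrow> (u, v) \<in> E'" if "u \<in> R" "v \<in> R" for u v
      using FR[OF that(1)] E'R[OF that(1)] that(2) by blast
    have RW: "(u, v) \<in> E \<longleftrightarrow> (u, v) \<in> E'" if "u \<in> R" "v \<in> W" for u v
    proof -
      have "E' `` {u} \<inter> W = (if u \<in> P then W else {})"
        using that(1) z(1) by (auto simp: E' R_def W_def)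
      thus ?thesis using FP[OF that(1)] that(2) by blast
    qed
    have WW: "(u, v) \<in> E \<longleftrightarrow> (u, v) \<in> E'" if "u \<in> W" "v \<in> W" for u v
      using FW[OF that(1)] E'W(2)[OF that(1)] that(2) by blast
    have zv: "(z, v) \<in> E \<longleftrightarrow> (z, v) \<in> E'" for v using zN E'z by blast
    have sym: "(u, v) \<in> E \<longleftrightarrow> (v, u) \<in> E" "(u, v) \<in> E' \<longleftrightarrow> (v, u) \<in> E'" for u v
      using E(2) symE' by (blast dest: symD)+
    have "u \<in> R \<or> u = z \<or> u \<in> W" "v \<in> R \<or> v = z \<or> v \<in> W" using VRW that by auto
    thus ?thesis by (elim disjE) (metis RR RW WW zv sym)+
  qed
  have "(u, v) \<in> E \<longleftrightarrow> (u, v) \<in> E'" for u v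
    using cases[of u v] E(1) E'V by blast
  hence "E = E'" by (auto simp: set_eq_iff)
  thus ?thesis using P unfolding E'_def R_def by blast
qed

section \<open>Graphs\<close>

lemma adj_matrix_carrier:
  assumes "finite (pverts G)"
  shows "adj_matrix G \<in> carrier_mat (card (pverts G)) (card (pverts G))"
proof -
  have "length (vertex_list G) = card (pverts G)"
    using finite_vertex_list[OF assms] distinct_card by metis
  thus ?thesis by (simp add: adj_matrix_def Let_def)
qed

text \<open>The maximiser is an eigenvector, so its quotient is an eigenvalue and at most the
  spectral radius. Conversely, given a complex eigenvector for \<open>k\<close>, the triangle
  inequality gives its vector of moduli a Rayleigh quotient of at least
  \<open>norm k\<close>.\<close>

lemma graph_spectral_radius_eq_max_rayleigh:
  assumes G: "pair_graph G" and ne: "pverts G \<noteq> {}"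
    and x0: "\<And>v. v \<in> pverts G \<Longrightarrow> 0 \<le> x v" and x1: "(\<Sum>v\<in>pverts G. (x v)\<^sup>2) = 1"
    and max: "\<And>y. bil (parcs G) y y \<le> bil (parcs G) x x * (\<Sum>v\<in>pverts G. (y v)\<^sup>2)"
  shows "graph_spectral_radius G = bil (parcs G) x x"
proof (rule antisym)
  let ?V = "pverts G" and ?E = "parcs G"
  define l where "l = bil ?E x x"
  have fin: "finite ?V" and E: "?E \<subseteq> ?V \<times> ?V" "sym ?E" "irrefl ?E"
    using G by (auto simp: pair_graph_iff irrefl_def)
  have nbr: "{v. v \<in> ?V \<and> (u, v) \<in> ?E} = ?E `` {u}" for u using E(1) by auto
  have eig: "(\<Sum>v\<in>?E `` {u}. x v) = l * x u" if "u \<in> ?V" for u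
    using rayleigh_maximizer_eigenvector[OF fin E _ _ that, of x l] max x1 by (simp add: l_def)
  have n0: "card ?V > 0" using fin ne by (simp add: card_gt_0_iff)
  note mem = spectral_radius_mem_max[OF adj_matrix_carrier[OF fin] n0]
  have l0: "0 \<le> l" unfolding l_def bil_def using x0 E(1) by (intro sum_nonneg mult_nonneg_nonneg) auto
  have "\<exists>v\<in>?V. x v \<noteq> 0"
  proof (rule ccontr)
    assume "\<not> ?thesis"
    hence "(\<Sum>v\<in>?V. (x v)\<^sup>2) = 0" by simp
    thus False using x1 by simp
  qed
  hence "eigenvalue (adj_matrix G) (complex_of_real l)"
    unfolding eigenvalue_adj_matrix_iff[OF fin] nbr
    by (intro exI[of _ "\<lambda>v. complex_of_real (x v)"]) (simp add: eig flip: of_real_sum of_real_mult)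
  hence "complex_of_real l \<in> spectrum (adj_matrix G)" by (simp add: spectrum_def)
  from mem(2)[OF imageI[OF this]] show "l \<le> graph_spectral_radius G"
    using l0 by (simp add: graph_spectral_radius_def)
  obtain k where k: "k \<in> spectrum (adj_matrix G)" "graph_spectral_radius G = norm k"
    using mem(1) unfolding graph_spectral_radius_def by auto
  hence "eigenvalue (adj_matrix G) k" by (simp add: spectrum_def)
  then obtain f where f: "\<exists>v\<in>?V. f v \<noteq> 0" "\<And>u. u \<in> ?V \<Longrightarrow> (\<Sum>v\<in>?E `` {u}. f v) = k * f u"
    unfolding eigenvalue_adj_matrix_iff[OF fin] nbr by auto
  define y where "y v = norm (f v)" for v
  have "norm k * (\<Sum>v\<in>?V. (y v)\<^sup>2) = (\<Sum>u\<in>?V. y u * norm (k * f u))"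
    by (simp add: sum_distrib_left y_def norm_mult power2_eq_square mult_ac)
  also have "\<dots> = (\<Sum>u\<in>?V. y u * norm (\<Sum>v\<in>?E `` {u}. f v))"
    by (intro sum.cong) (simp_all add: f(2))
  also have "\<dots> \<le> (\<Sum>u\<in>?V. y u * (\<Sum>v\<in>?E `` {u}. y v))"
    unfolding y_def by (intro sum_mono mult_left_mono norm_sum) auto
  also have "\<dots> = bil ?E y y" by (rule bil_rows[OF fin E(1), symmetric])
  also have "\<dots> \<le> l * (\<Sum>v\<in>?V. (y v)\<^sup>2)" unfolding l_def by (rule max)
  finally have "norm k * (\<Sum>v\<in>?V. (y v)\<^sup>2) \<le> l * (\<Sum>v\<in>?V. (y v)\<^sup>2)" .
  moreover have "0 < (\<Sum>v\<in>?V. (y v)\<^sup>2)"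
  proof -
    obtain v where v: "v \<in> ?V" "f v \<noteq> 0" using f(1) by blast
    show ?thesis using v fin by (intro sum_pos2[of _ v]) (auto simp: y_def)
  qed
  ultimately show "graph_spectral_radius G \<le> l" using k(2) by simp
qed

lemma ex_perron_vector:
  assumes G: "pair_graph G" and ne: "pverts G \<noteq> {}"
  obtains x where "\<And>v. v \<in> pverts G \<Longrightarrow> 0 \<le> x v" "(\<Sum>v\<in>pverts G. (x v)\<^sup>2) = 1"
    "bil (parcs G) x x = graph_spectral_radius G"
    "\<And>y. bil (parcs G) y y \<le> graph_spectral_radius G * (\<Sum>v\<in>pverts G. (y v)\<^sup>2)"
proof -
  have fin: "finite (pverts G)" and E: "parcs G \<subseteq> pverts G \<times> pverts G"
    using G by (auto simp: pair_graph_iff)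
  obtain x where x: "\<And>v. v \<in> pverts G \<Longrightarrow> 0 \<le> x v" "(\<Sum>v\<in>pverts G. (x v)\<^sup>2) = 1"
    "\<And>y. bil (parcs G) y y \<le> bil (parcs G) x x * (\<Sum>v\<in>pverts G. (y v)\<^sup>2)"
    using ex_rayleigh_maximizer[OF fin ne E] by blast
  have "graph_spectral_radius G = bil (parcs G) x x"
    by (rule graph_spectral_radius_eq_max_rayleigh[OF G ne x])
  thus ?thesis using that[of x] x by simp
qed

lemma connected_cut_nonempty:
  assumes G: "pair_graph G" and conn: "Digraph_Component.connected G"
    and S: "S \<subseteq> pverts G" "S \<noteq> {}" "S \<noteq> pverts G"
  shows "\<exists>u\<in>S. \<exists>v\<in>pverts G - S. (u, v) \<in> parcs G"
proof (rule ccontr)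
  assume no: "\<not> ?thesis"
  interpret pair_graph G by fact
  have E: "parcs G \<subseteq> pverts G \<times> pverts G" using G by (simp add: pair_graph_iff)
  have "strongly_connected G"
    using symmetric_connected_imp_strongly_connected[OF sym_arcs conn] .
  moreover obtain u v where u: "u \<in> S" and v: "v \<in> pverts G - S" using S by blast
  ultimately have "u \<rightarrow>\<^sup>*\<^bsub>with_proj G\<^esub> v" using S by (auto simp: strongly_connected_def)
  hence "v \<in> S"
  proof (induction rule: reachable_induct)
    case base
    show ?case by (rule u)
  next
    case (step x y)
    hence "(x, y) \<in> parcs G" by simp
    thus ?case using step(3) no E by blast
  qed
  thus False using v by simp
qed

section \<open>Isomorphisms and relabelling\<close>

lemma bij_betw_parcs:
  assumes G: "pair_graph G" and H: "pair_graph H" and h: "bij_betw h (pverts G) (pverts H)"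
    and arcs: "\<And>u v. u \<in> pverts G \<Longrightarrow> v \<in> pverts G \<Longrightarrow> (u, v) \<in> parcs G \<longleftrightarrow> (h u, h v) \<in> parcs H"
  shows "bij_betw (map_prod h h) (parcs G) (parcs H)"
proof -
  have E: "parcs G \<subseteq> pverts G \<times> pverts G" "parcs H \<subseteq> pverts H \<times> pverts H"
    using G H by (simp_all add: pair_graph_iff)
  have inj: "inj_on h (pverts G)" and im: "h ` pverts G = pverts H"
    using h by (auto simp: bij_betw_def)
  have imE: "map_prod h h ` parcs G = parcs H"
  proof
    show "map_prod h h ` parcs G \<subseteq> parcs H" using E(1) arcs by auto
    show "parcs H \<subseteq> map_prod h h ` parcs G"
    proof
      fix p assume p: "p \<in> parcs H"
      then obtain u v where "u \<in> pverts G" "v \<in> pverts G" "p = (h u, h v)"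
        using E(2) unfolding im[symmetric] by auto
      thus "p \<in> map_prod h h ` parcs G" using arcs[of u v] p by force
    qed
  qed
  have injE: "inj_on (map_prod h h) (parcs G)"
    using map_prod_inj_on[OF inj inj] E(1) by (rule inj_on_subset)
  show ?thesis using injE imE by (simp add: bij_betw_def)
qed

lemma digraph_isoI:
  assumes G: "pair_graph G" and H: "pair_graph H" and h: "bij_betw h (pverts G) (pverts H)"
    and arcs: "\<And>u v. u \<in> pverts G \<Longrightarrow> v \<in> pverts G \<Longrightarrow> (u, v) \<in> parcs G \<longleftrightarrow> (h u, h v) \<in> parcs H"
  shows "digraph_iso G H"
proof -
  interpret pair_graph G by fact
  have inj: "inj_on h (pverts G)" and im: "h ` pverts G = pverts H"
    using h by (auto simp: bij_betw_def)
  have injE: "inj_on (map_prod h h) (parcs G)" and imE: "map_prod h h ` parcs G = parcs H"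
    using bij_betw_parcs[OF assms] by (auto simp: bij_betw_def)
  define i where "i = \<lparr>iso_verts = h, iso_arcs = map_prod h h, iso_head = snd, iso_tail = fst\<rparr>"
  have "digraph_isomorphism i"
    unfolding digraph_isomorphism_def using inj injE wf_digraph_axioms by (auto simp: i_def)
  moreover have "with_proj H = app_iso i (with_proj G)"
    by (simp add: app_iso_def i_def with_proj_def im imE)
  ultimately show ?thesis unfolding digraph_iso_def by blast
qed

text \<open>Carries bounds from the extremal graph, which has its own vertex type, to its copies on
  the vertices of \<open>G\<close>; a test vector is pulled along the bijection.\<close>

lemma rayleigh_transport:
  assumes h: "bij_betw h V V'" and hE: "bij_betw (map_prod h h) E E'" and E: "E \<subseteq> V \<times> V"
    and ray: "\<And>y. bil E' y y \<le> l * (\<Sum>v\<in>V'. (y v)\<^sup>2)"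
  shows "bil E y y \<le> l * (\<Sum>v\<in>V. (y v)\<^sup>2)"
proof -
  define y' where "y' = y \<circ> the_inv_into V h"
  have y': "y' (h v) = y v" if "v \<in> V" for v
    using that h by (simp add: y'_def bij_betw_def the_inv_into_f_f)
  have "bil E' y' y' = (\<Sum>p\<in>E. y' (h (fst p)) * y' (h (snd p)))"
    unfolding bil_def using sum.reindex_bij_betw[OF hE, of "\<lambda>p. y' (fst p) * y' (snd p)"] by simp
  also have "\<dots> = bil E y y"
    unfolding bil_def using E y' by (intro sum.cong) auto
  finally have "bil E' y' y' = bil E y y" .
  moreover have "(\<Sum>v\<in>V'. (y' v)\<^sup>2) = (\<Sum>v\<in>V. (y v)\<^sup>2)"
    using sum.reindex_bij_betw[OF h, of "\<lambda>v. (y' v)\<^sup>2"] y' by simp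
  ultimately show ?thesis using ray[of y'] by simp
qed

section \<open>Adjacency, copies and spectral radius of the extremal graph\<close>

lemmas extremal_graph_unfold = extremal_graph_def add_vertex_def graph_join_def disjoint_union_def
  complete_graph_def edgeless_graph_def

lemma map_prod_image_iff:
  assumes "inj f"
  shows "(f u, f v) \<in> map_prod f f ` A \<longleftrightarrow> (u, v) \<in> A"
proof
  show "(u, v) \<in> A" if "(f u, f v) \<in> map_prod f f ` A" using that assms by (auto dest: injD)
  show "(f u, f v) \<in> map_prod f f ` A" if "(u, v) \<in> A"
    using that by (intro image_eqI[of _ _ "(u, v)"]) auto
qed

lemma parcs_extremal_graph_iff:
  "(None, None) \<notin> parcs (extremal_graph n a)"
  "(None, Some (Inl i)) \<notin> parcs (extremal_graph n a)"
  "(Some (Inl i), None) \<notin> parcs (extremal_graph n a)"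
  "(None, Some (Inr (Inl i))) \<notin> parcs (extremal_graph n a)"
  "(Some (Inr (Inl i)), None) \<notin> parcs (extremal_graph n a)"
  "(None, Some (Inr (Inr i))) \<in> parcs (extremal_graph n a) \<longleftrightarrow> i < Suc a"
  "(Some (Inr (Inr i)), None) \<in> parcs (extremal_graph n a) \<longleftrightarrow> i < Suc a"
  "(Some (Inl i), Some (Inl j)) \<in> parcs (extremal_graph n a) \<longleftrightarrow> i < a - 1 \<and> j < a - 1 \<and> i \<noteq> j"
  "(Some (Inl i), Some (Inr (Inl k))) \<in> parcs (extremal_graph n a) \<longleftrightarrow> i < a - 1 \<and> k < n - 2 * a - 1"
  "(Some (Inr (Inl k)), Some (Inl i)) \<in> parcs (extremal_graph n a) \<longleftrightarrow> i < a - 1 \<and> k < n - 2 * a - 1"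
  "(Some (Inl i), Some (Inr (Inr l))) \<in> parcs (extremal_graph n a) \<longleftrightarrow> i < a - 1 \<and> l < Suc a"
  "(Some (Inr (Inr l)), Some (Inl i)) \<in> parcs (extremal_graph n a) \<longleftrightarrow> i < a - 1 \<and> l < Suc a"
  "(Some (Inr (Inl k)), Some (Inr (Inl m))) \<in> parcs (extremal_graph n a) \<longleftrightarrow>
    k < n - 2 * a - 1 \<and> m < n - 2 * a - 1 \<and> k \<noteq> m"
  "(Some (Inr (Inl k)), Some (Inr (Inr l))) \<notin> parcs (extremal_graph n a)"
  "(Some (Inr (Inr l)), Some (Inr (Inl k))) \<notin> parcs (extremal_graph n a)"
  "(Some (Inr (Inr l)), Some (Inr (Inr m))) \<notin> parcs (extremal_graph n a)"
  by (auto simp: extremal_graph_unfold map_prod_image_iff)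

lemma pverts_extremal_graph:
  "pverts (extremal_graph n a) = {None} \<union> (\<lambda>i. Some (Inl i)) ` {..<a - 1} \<union>
    (\<lambda>i. Some (Inr (Inl i))) ` {..<n - 2 * a - 1} \<union> (\<lambda>i. Some (Inr (Inr i))) ` {..<a + 1}"
  by (auto simp: extremal_graph_unfold)

text \<open>Four blocks are matched: \<open>z\<close> with the added vertex, \<open>W\<close> with
  the independent set, \<open>P\<close> with the clique of order \<open>a - 1\<close>, and the
  remaining \<open>Q\<close> with the large clique.\<close>

lemma ext_arcs_extremal_graph:
  assumes fin: "finite V" and T: "T \<subseteq> V" "card T = a + 2" and z: "z \<in> T"
    and P: "P \<subseteq> V - T" "card P = a - 1" and n: "card V = n" and a: "2 \<le> a"
  obtains h where "bij_betw h V (pverts (extremal_graph n a))"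
    "\<And>u v. u \<in> V \<Longrightarrow> v \<in> V \<Longrightarrow>
      (u, v) \<in> ext_arcs V T z P \<longleftrightarrow> (h u, h v) \<in> parcs (extremal_graph n a)"
proof -
  define W where "W = T - {z}"
  define Q where "Q = V - T - P"
  have finT: "finite T" using T(1) fin by (rule finite_subset)
  have finP: "finite P" using P(1) finite_Diff[OF fin] by (rule finite_subset)
  have finW: "finite W" and finQ: "finite Q" using fin finT by (auto simp: W_def Q_def)
  have cW: "card W = a + 1" using T(2) z finT by (simp add: W_def)
  have "card Q = card (V - T) - card P" unfolding Q_def using P(1) finP by (intro card_Diff_subset)
  also have "card (V - T) = n - (a + 2)" using T finT n by (simp add: card_Diff_subset)
  finally have cQ: "card Q = n - 2 * a - 1" using P(2) a by simp
  have ex: "\<exists>f. bij_betw f A {..<card A}" if "finite A" for A :: "'a set"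
    using ex_bij_betw_finite_nat[OF that] by (simp add: atLeast0LessThan)
  obtain fW where fW: "bij_betw fW W {..<a + 1}" using ex[OF finW] cW by auto
  obtain fP where fP: "bij_betw fP P {..<a - 1}" using ex[OF finP] P(2) by auto
  obtain fQ where fQ: "bij_betw fQ Q {..<n - 2 * a - 1}" using ex[OF finQ] cQ by auto
  have mW: "fW w < Suc a" if "w \<in> W" for w using bij_betwE[OF fW] that by auto
  have mP: "fP w < a - 1" if "w \<in> P" for w using bij_betwE[OF fP] that by auto
  have mQ: "fQ w < n - 2 * a - 1" if "w \<in> Q" for w using bij_betwE[OF fQ] that by auto
  have iP: "fP u = fP v \<longleftrightarrow> u = v" if "u \<in> P" "v \<in> P" for u v
    using bij_betw_imp_inj_on[OF fP] that by (auto dest: inj_onD)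
  have iQ: "fQ u = fQ v \<longleftrightarrow> u = v" if "u \<in> Q" "v \<in> Q" for u v
    using bij_betw_imp_inj_on[OF fQ] that by (auto dest: inj_onD)
  define h where "h v = (if v = z then None else if v \<in> W then Some (Inr (Inr (fW v)))
    else if v \<in> P then Some (Inl (fP v)) else Some (Inr (Inl (fQ v))))" for v
  have disj: "z \<notin> W" "z \<notin> P" "z \<notin> Q" "W \<inter> P = {}" "W \<inter> Q = {}" "P \<inter> Q = {}"
    using z P(1) by (auto simp: W_def Q_def)
  have V: "V = {z} \<union> P \<union> Q \<union> W" using T z P(1) by (auto simp: W_def Q_def)
  have hz: "h z = None" by (simp add: h_def)
  have hW: "h v = Some (Inr (Inr (fW v)))" if "v \<in> W" for v using that disj by (auto simp: h_def)
  have hP: "h v = Some (Inl (fP v))" if "v \<in> P" for v using that disj by (auto simp: h_def)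
  have hQ: "h v = Some (Inr (Inl (fQ v)))" if "v \<in> Q" for v using that disj by (auto simp: h_def)
  have comp: "bij_betw h A (g ` B)" if "bij_betw f A B" "inj g" "\<And>v. v \<in> A \<Longrightarrow> h v = g (f v)"
    for f :: "'a \<Rightarrow> nat" and g A B
  proof -
    have "bij_betw g B (g ` B)" using that(2) by (auto simp: bij_betw_def intro: inj_on_subset)
    hence "bij_betw (g \<circ> f) A (g ` B)" by (rule bij_betw_trans[OF that(1)])
    thus ?thesis using that(3) by (subst bij_betw_cong[of A h "g \<circ> f"]) auto
  qed
  have "bij_betw h {z} {None}" by (simp add: hz bij_betw_def)
  moreover have "bij_betw h P ((\<lambda>i. Some (Inl i)) ` {..<a - 1})"
    by (rule comp[OF fP]) (auto simp: hP inj_def)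
  moreover have "bij_betw h Q ((\<lambda>i. Some (Inr (Inl i))) ` {..<n - 2 * a - 1})"
    by (rule comp[OF fQ]) (auto simp: hQ inj_def)
  moreover have "bij_betw h W ((\<lambda>i. Some (Inr (Inr i))) ` {..<a + 1})"
    by (rule comp[OF fW]) (auto simp: hW inj_def)
  ultimately have "bij_betw h V (pverts (extremal_graph n a))"
    unfolding V pverts_extremal_graph by (intro bij_betw_combine) auto
  moreover have "(u, v) \<in> ext_arcs V T z P \<longleftrightarrow> (h u, h v) \<in> parcs (extremal_graph n a)"
    if "u \<in> V" "v \<in> V" for u v
  proof -
    have mem: "(u, v) \<in> ext_arcs V T z P \<longleftrightarrow>
        (u \<in> P \<or> u \<in> Q) \<and> (v \<in> P \<or> v \<in> Q) \<and> u \<noteq> v \<or> u = z \<and> v \<in> W \<or> u \<in> W \<and> v = z \<or>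
        u \<in> W \<and> v \<in> P \<or> u \<in> P \<and> v \<in> W" for u v
      using P(1) by (auto simp: ext_arcs_def W_def Q_def)
    have "w = z \<and> w \<notin> P \<and> w \<notin> Q \<and> w \<notin> W \<or> w \<noteq> z \<and> w \<in> P \<and> w \<notin> Q \<and> w \<notin> W \<or>
      w \<noteq> z \<and> w \<notin> P \<and> w \<in> Q \<and> w \<notin> W \<or> w \<noteq> z \<and> w \<notin> P \<and> w \<notin> Q \<and> w \<in> W" if "w \<in> V" for w
      using that disj by (auto simp: V disjoint_iff)
    note split = this
    define p q r where "p = a - 1" and "q = n - 2 * a - 1" and "r = Suc a"
    note bounds = mP[folded p_def] mQ[folded q_def] mW[folded r_def]
    note iff = parcs_extremal_graph_iff[where n = n and a = a, folded p_def q_def r_def]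
    have ne: "x \<in> P \<Longrightarrow> y \<notin> P \<Longrightarrow> (x = y) = False" "x \<notin> P \<Longrightarrow> y \<in> P \<Longrightarrow> (x = y) = False" for x y
      by blast+
    from split[OF \<open>u \<in> V\<close>] split[OF \<open>v \<in> V\<close>] show ?thesis
      unfolding mem
      by (elim disjE conjE) (simp_all only: hz hW hP hQ iff bounds iP iQ ne simp_thms)
  qed
  ultimately show ?thesis by (rule that)
qed

text \<open>The indicator vector of a clique has Rayleigh quotient its order minus one; the clique
  \<open>C\<close> consists of the two complete blocks.\<close>

lemma extremal_graph_spectral_radius_ge:
  assumes a: "1 \<le> a" and n: "2 * a + 2 \<le> n"
  shows "real n - real a - 3 \<le> graph_spectral_radius (extremal_graph n a)"
proof -
  let ?G = "extremal_graph n a"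
  have ne: "pverts ?G \<noteq> {}" by (simp add: pverts_extremal_graph)
  have finE: "finite (parcs ?G)"
    using pair_graph_extremal_graph[of n a] unfolding pair_graph_iff
    by (meson finite_SigmaI finite_subset)
  have finV: "finite (pverts ?G)"
    using pair_graph_extremal_graph[of n a] unfolding pair_graph_iff by blast
  define C :: "(nat + nat + nat) option set" where
    "C = (\<lambda>i. Some (Inl i)) ` {..<a - 1} \<union> (\<lambda>i. Some (Inr (Inl i))) ` {..<n - 2 * a - 1}"
  have CV: "C \<subseteq> pverts ?G" by (auto simp: C_def pverts_extremal_graph)
  have finC: "finite C" by (simp add: C_def)
  have "card C = (a - 1) + (n - 2 * a - 1)"
    unfolding C_def by (subst card_Un_disjoint) (auto simp: card_image inj_on_def)
  hence cC: "real (card C) = real n - real a - 2" using a n by (simp add: of_nat_diff)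
  have CE: "C \<times> C - Id \<subseteq> parcs ?G"
    by (auto simp: C_def parcs_extremal_graph_iff)
  define y :: "(nat + nat + nat) option \<Rightarrow> real" where "y v = (if v \<in> C then 1 else 0)" for v
  obtain x where "\<And>y. bil (parcs ?G) y y \<le> graph_spectral_radius ?G * (\<Sum>v\<in>pverts ?G. (y v)\<^sup>2)"
    using ex_perron_vector[OF pair_graph_extremal_graph ne] by blast
  hence ray: "bil (parcs ?G) y y \<le> graph_spectral_radius ?G * (\<Sum>v\<in>pverts ?G. (y v)\<^sup>2)" .
  have "(\<Sum>v\<in>pverts ?G. (y v)\<^sup>2) = (\<Sum>v\<in>C. (y v)\<^sup>2)"
    using CV finV by (intro sum.mono_neutral_right) (auto simp: y_def)
  hence y2: "(\<Sum>v\<in>pverts ?G. (y v)\<^sup>2) = real (card C)" by (simp add: y_def)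
  have "bil (C \<times> C - Id) y y = (\<Sum>u\<in>C. y u * (\<Sum>v\<in>(C \<times> C - Id) `` {u}. y v))"
    using finC by (intro bil_rows) auto
  also have "\<dots> = (\<Sum>u\<in>C. real (card C) - 1)"
  proof (rule sum.cong)
    fix u assume u: "u \<in> C"
    have "(C \<times> C - Id) `` {u} = C - {u}" using u by auto
    moreover have "card C \<ge> 1" using u finC by (auto simp: Suc_le_eq card_gt_0_iff)
    ultimately show "y u * (\<Sum>v\<in>(C \<times> C - Id) `` {u}. y v) = real (card C) - 1"
      using u finC by (simp add: y_def of_nat_diff)
  qed simp
  finally have "bil (C \<times> C - Id) y y = real (card C) * (real (card C) - 1)" by simp
  moreover have "bil (C \<times> C - Id) y y \<le> bil (parcs ?G) y y"
    by (rule bil_mono[OF finE CE]) (simp add: y_def)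
  ultimately have "real (card C) * (real (card C) - 1) \<le> real (card C) * graph_spectral_radius ?G"
    using ray unfolding y2 by (simp add: mult.commute)
  moreover have "0 < real (card C)" using cC a n by simp
  ultimately have "real (card C) - 1 \<le> graph_spectral_radius ?G" by simp
  thus ?thesis using cC by simp
qed

section \<open>Assembling the theorem\<close>

lemma out_degree_eq_deg: "out_degree (with_proj G) v = deg (parcs G) v"
proof -
  have "out_arcs (with_proj G) v = Pair v ` (parcs G `` {v})" by (auto simp: out_arcs_def)
  thus ?thesis by (simp add: out_degree_def card_image inj_on_def)
qed

theorem theorem1p3:
  fixes a b n :: nat and G :: "'v pair_pre_digraph"
  assumes "2 \<le> a" and "a < b" and "a mod 2 = b mod 2" and "even (n * a)"
    and "pair_graph G" and "Digraph_Component.connected G" and "card (pverts G) = n"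
    and "n \<ge> max (2 * a\<^sup>2 + 136 * a + 264) (2 * b\<^sup>2 + 5 * a * b + 7 * b + 34)"
    and "min_degree G \<ge> a"
    and "graph_spectral_radius G \<ge> graph_spectral_radius (extremal_graph n a)"
    and "\<not> digraph_iso G (extremal_graph n a)"
  shows "\<exists>H. parity_factor a b H G"
proof -
  note a = assms(1) and G = assms(5) and conn = assms(6) and n = assms(7)
  let ?\<rho> = "graph_spectral_radius G"
  define V where "V = pverts G"
  define E where "E = parcs G"
  have fin: "finite V" and E: "E \<subseteq> V \<times> V" "sym E" "irrefl E"
    using G by (auto simp: pair_graph_iff irrefl_def V_def E_def)
  have cV: "card V = n" using n by (simp add: V_def)
  \<comment> \<open>Equal parity sharpens \<open>a < b\<close>, so both target degrees
    \<open>a\<close> and \<open>a + 2\<close> are admissible.\<close>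
  have b: "a + 2 \<le> b" using assms(2,3) by presburger
  have n1: "2 * a\<^sup>2 + 136 * a + 264 \<le> n" and n2: "2 * b\<^sup>2 + 5 * a * b + 7 * b + 34 \<le> n"
    using assms(8) by simp_all
  \<comment> \<open>The right-hand side is the second bound on \<open>n\<close> at
    \<open>b = a + 2\<close>, the least possible \<open>b\<close>; expanded, the two sides
    agree.\<close>
  have "7 * a\<^sup>2 + 25 * a + 56 \<le> 2 * (a + 2)\<^sup>2 + 5 * a * (a + 2) + 7 * (a + 2) + 34"
    by (simp add: power2_eq_square algebra_simps)
  also have "\<dots> \<le> 2 * b\<^sup>2 + 5 * a * b + 7 * b + 34"
    using b by (intro add_mono mult_le_mono power_mono) auto
  finally have n3: "7 * a\<^sup>2 + 25 * a + 56 \<le> n" using n2 by simp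
  have dega: "a \<le> deg E v" if "v \<in> V" for v
  proof -
    have "min_degree G \<le> out_degree G v"
      unfolding min_degree_def using fin that by (intro Min_le) (auto simp: V_def)
    thus ?thesis using assms(9) by (simp add: out_degree_eq_deg E_def)
  qed
  have ne: "V \<noteq> {}" using cV n1 by auto
  obtain x where x0: "\<And>v. v \<in> V \<Longrightarrow> 0 \<le> x v" and x1: "(\<Sum>v\<in>V. (x v)\<^sup>2) = 1"
    and xE: "bil E x x = ?\<rho>" and ray: "\<And>y. bil E y y \<le> ?\<rho> * (\<Sum>v\<in>V. (y v)\<^sup>2)"
    using ex_perron_vector[OF G] ne unfolding V_def E_def by blast
  have xE': "bil E x x = ?\<rho> * (\<Sum>v\<in>V. (x v)\<^sup>2)" using xE x1 by simp
  have eig: "(\<Sum>v\<in>E `` {u}. x v) = ?\<rho> * x u" if "u \<in> V" for u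
    by (rule rayleigh_maximizer_eigenvector[OF fin E xE' ray that])
  have xn: "\<exists>v\<in>V. x v \<noteq> 0"
  proof (rule ccontr)
    assume "\<not> ?thesis"
    hence "(\<Sum>v\<in>V. (x v)\<^sup>2) = 0" by simp
    thus False using x1 by simp
  qed
  have cut: "\<exists>u\<in>S. \<exists>v\<in>V - S. (u, v) \<in> E" if "S \<subseteq> V" "S \<noteq> {}" "S \<noteq> V" for S
    using connected_cut_nonempty[OF G conn] that by (simp add: V_def E_def)
  have pos: "0 < x v" if "v \<in> V" for v
    by (rule eigenvector_pos[OF fin E(1) cut x0 xn eig that])
  have na: "a + 3 \<le> n" using n1 by simp
  have rho: "real n - real a - 3 \<le> ?\<rho>"
    using extremal_graph_spectral_radius_ge[of a n] a n1 assms(10) by simp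
  hence rho0: "0 \<le> ?\<rho>" using na by simp
  have "?\<rho>\<^sup>2 + real (card V) - 1 \<le> real (card E)"
  proof (rule eigenvalue_square_le[OF fin E _ x0 xn rho0 eig])
    show "1 \<le> deg E v" if "v \<in> V" for v using dega[OF that] a by simp
  qed
  moreover have "(real n - real a - 3)\<^sup>2 \<le> ?\<rho>\<^sup>2"
    using rho na by (intro power_mono) auto
  ultimately have "real_of_int ((int n - int a - 3)\<^sup>2 + int n - 1) \<le> real_of_int (int (card E))"
    using cV by simp
  hence dense: "(int (card V) - int a - 3)\<^sup>2 + int (card V) - 1 \<le> int (card E)"
    using cV by (simp only: of_int_le_iff)
  define T where "T = {v \<in> V. deg E v < 5 * a + 12}"
  define M where "M = {v \<in> V. 2 * deg E v < card V + 6 * a + 23}"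
  have cT: "card T \<le> a + 2" and cM: "card M \<le> 2 * a + 6"
    unfolding T_def M_def
    using card_low_degree_le[OF fin E a _ dense] card_half_degree_le[OF fin E a _ _ dense] n1 n3 cV
    by simp_all
  have TM: "T \<subseteq> M" "M \<subseteq> V" using n1 cV by (auto simp: T_def M_def)
  have TV: "T \<subseteq> V" using TM by blast
  have good: "\<not> (card T = a + 2 \<and> odd (card {z \<in> T. E `` {z} = T - {z}}) \<and>
      (\<forall>t\<in>T. E `` {t} \<noteq> T - {t} \<longrightarrow> deg E t = a))"
  proof
    assume bad: "card T = a + 2 \<and> odd (card {z \<in> T. E `` {z} = T - {z}}) \<and>
      (\<forall>t\<in>T. E `` {t} \<noteq> T - {t} \<longrightarrow> deg E t = a)"
    hence "{z \<in> T. E `` {z} = T - {z}} \<noteq> {}" by (metis card.empty even_zero)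
    then obtain z where z: "z \<in> T" "E `` {z} = T - {z}" by blast
    have iso: "\<exists>h. bij_betw h V (pverts (extremal_graph n a)) \<and> (\<forall>u\<in>V. \<forall>v\<in>V.
        (u, v) \<in> ext_arcs V T z P \<longleftrightarrow> (h u, h v) \<in> parcs (extremal_graph n a))"
      if "P \<subseteq> V - T" "card P = a - 1" for P
    proof (rule ext_arcs_extremal_graph[OF fin TV _ z(1) that cV a])
      show "card T = a + 2" using bad by simp
    qed blast
    \<comment> \<open>Every choice of \<open>P\<close> yields a copy of the extremal graph, so the
      assumed comparison of spectral radii bounds all their Rayleigh quotients by that of
      \<open>G\<close>.\<close>
    have "\<exists>P. P \<subseteq> V - T \<and> card P = a - 1 \<and> E = ext_arcs V T z P"
    proof (rule bad_case_eq_ext_arcs[OF fin E a cV n1 TV _ z _ pos xE' ray rho])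
      fix P and y :: "'v \<Rightarrow> real"
      assume P: "P \<subseteq> V - T" "card P = a - 1"
      obtain h where h: "bij_betw h V (pverts (extremal_graph n a))"
        "\<forall>u\<in>V. \<forall>v\<in>V. (u, v) \<in> ext_arcs V T z P \<longleftrightarrow> (h u, h v) \<in> parcs (extremal_graph n a)"
        using iso[OF P] by blast
      let ?H = "\<lparr>pverts = V, parcs = ext_arcs V T z P\<rparr>"
      have EV: "ext_arcs V T z P \<subseteq> V \<times> V" using P TV z by (auto simp: ext_arcs_def)
      have "pair_graph ?H"
        using fin EV P z by (auto simp: pair_graph_iff ext_arcs_def sym_def)
      hence hE: "bij_betw (map_prod h h) (ext_arcs V T z P) (parcs (extremal_graph n a))"
        using bij_betw_parcs[OF _ pair_graph_extremal_graph, of ?H h n a] h by simp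
      have "pverts (extremal_graph n a) \<noteq> {}" by (simp add: pverts_extremal_graph)
      then obtain x' where "\<And>y. bil (parcs (extremal_graph n a)) y y \<le>
          graph_spectral_radius (extremal_graph n a) * (\<Sum>v\<in>pverts (extremal_graph n a). (y v)\<^sup>2)"
        using ex_perron_vector[OF pair_graph_extremal_graph] by blast
      hence "bil (ext_arcs V T z P) y y \<le> graph_spectral_radius (extremal_graph n a) * (\<Sum>v\<in>V. (y v)\<^sup>2)"
        by (rule rayleigh_transport[OF h(1) hE EV])
      also have "\<dots> \<le> ?\<rho> * (\<Sum>v\<in>V. (y v)\<^sup>2)"
        using assms(10) by (intro mult_right_mono sum_nonneg) auto
      finally show "bil (ext_arcs V T z P) y y \<le> ?\<rho> * (\<Sum>v\<in>V. (y v)\<^sup>2)" .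
    qed (use bad in auto)
    then obtain P where P: "P \<subseteq> V - T" "card P = a - 1" "E = ext_arcs V T z P" by blast
    obtain h where "bij_betw h V (pverts (extremal_graph n a))"
      "\<forall>u\<in>V. \<forall>v\<in>V. (u, v) \<in> E \<longleftrightarrow> (h u, h v) \<in> parcs (extremal_graph n a)"
      using iso[OF P(1,2)] P(3) by blast
    hence "digraph_iso G (extremal_graph n a)"
      using digraph_isoI[OF G pair_graph_extremal_graph, of h n a] by (simp add: V_def E_def)
    thus False using assms(11) by simp
  qed
  obtain F where F: "F \<subseteq> E" "sym F" "\<forall>v\<in>V. deg F v \<in> {a, a + 2}"
    using two_degree_factor[OF fin E a _ TM cT cM dega _ _ good] assms(4) cV
    by (auto simp: T_def M_def not_less)
  define H where "H = \<lparr>pverts = V, parcs = F\<rparr>"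
  have H: "pair_graph H" using F E fin by (auto simp: pair_graph_iff H_def irrefl_def)
  interpret G: pair_graph G by fact
  interpret H: pair_graph H by fact
  have "spanning H G"
    unfolding spanning_def subgraph_def
    using F(1) G.wf_digraph_axioms H.wf_digraph_axioms
    by (auto simp: H_def V_def E_def)
  moreover have "a \<le> out_degree H v \<and> out_degree H v \<le> b \<and>
      out_degree H v mod 2 = a mod 2 \<and> out_degree H v mod 2 = b mod 2" if "v \<in> pverts H" for v
  proof -
    have "deg F v = a \<or> deg F v = a + 2" using F(3) that by (simp add: H_def)
    thus ?thesis using b assms(3) by (auto simp: out_degree_eq_deg H_def)
  qed
  ultimately have "parity_factor a b H G" unfolding parity_factor_def using H by blast
  thus ?thesis by blast
qed

end
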